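(* Let $X_1,X_2,\dots$ be i.i.d. real random variables with $\mathbb{E}(X_1)=0$ and $0<\operatorname{Var}(X_1)<\infty$, and let $S(n)=\sum_{i=1}^{n}X_i$ for $n\ge 0$. Then for every $\varepsilon>0$, $$\mathbb{P}\left(\operatorname{LIS}(S|_{[0,n)})\leq n^{1/2+\varepsilon}\right)\to 1\quad\text{as } n\to\infty.$$
   Context: $\mathbb{N}=\{0,1,2,\dots\}$, and $[0,n)$ denotes $\{0,1,\dots,n-1\}$. For $S\colon\mathbb{N}\to\mathbb{R}$ and $A\subset\mathbb{N}$, $S|_A$ is called increasing if $S(a)\le S(b)$ for all $a,b\in A$ with $a\le b$ (weakly increasing). Define $\operatorname{LIS}(S|_{[0,n)})=\max\{|A|: A\subset[0,n),\ S|_A \text{ is increasing}\}$. *)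

theory Defs
  imports "HOL-Probability.Probability"
begin

definition LIS :: "(nat \<Rightarrow> real) \<Rightarrow> nat \<Rightarrow> nat" where
  "LIS S n = Max {card A |A. A \<subseteq> {0..<n} \<and> mono_on A S}"

definition partial_sum :: "(nat \<Rightarrow> 'a \<Rightarrow> real) \<Rightarrow> 'a \<Rightarrow> nat \<Rightarrow> real" where
  "partial_sum X \<omega> n = (\<Sum>i=1..n. X i \<omega>)"

end

theory Submission
  imports Defs "HOL-Real_Asymp.Real_Asymp"
begin

text \<open>
  The upper bound comes from covering an increasing set \<open>A\<close> by time blocks of shrinking length.
  Suppose that blocks of length \<open>b m\<close> are cut into \<open>b\<close> blocks of length \<open>m\<close>, and put
  \<open>\<delta> = sqrt m\<close>, the order of magnitude of the walk's displacement in time \<open>m\<close>.  Because the walk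
  increases along \<open>A\<close>, the heights that \<open>A\<close> gains inside the different long blocks add up to at
  most the total range \<open>V\<close> of the walk.  A long block in which \<open>A\<close> gains more than \<open>\<delta>\<close> may have all
  its \<open>b\<close> pieces visited by \<open>A\<close>, but there are at most \<open>V / \<delta>\<close> of these.  In any other long block
  \<open>A\<close> stays in a horizontal strip of height \<open>\<delta>\<close>, so that only pieces during which the walk meets
  this strip count; if there are never more than \<open>q\<close> of them, then the numbers \<open>N\<close> of visited blocks
  satisfy \<open>N(m) \<le> q N(b m) + b V / \<delta>\<close> (\<open>card_blocks_refine\<close>).

  For the walk, \<open>q\<close> can be taken slightly above \<open>sqrt b\<close>, uniformly over all blocks and all strips.
  The expected number of pieces meeting a given strip is \<open>O(sqrt b)\<close> from every starting point
  (\<open>expected_hit_blocks\<close>): a convex function that is quadratic near the strip and linear far away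
  grows in expectation by a fixed amount with each visit, but by at most its slope times the expected
  displacement in total.  By the Markov property the \<open>p\<close>-th factorial moment is then at most the
  \<open>p\<close>-th power of this bound (\<open>factorial_moment_hit_blocks\<close>), so an excess by a factor \<open>w\<close> has
  probability \<open>O(1 / w ^ p)\<close> for each \<open>p\<close> (\<open>hit_blocks_tail\<close>).

  All parameters are powers of one integer \<open>w\<close>: with \<open>s = w ^ K\<close> the time horizon is \<open>s ^ (2 * K)\<close>,
  each of the \<open>K\<close> refinements cuts a block into \<open>b = s\<^sup>2\<close> pieces, \<open>q = s * w\<close>, and
  \<open>V = s ^ (K + 2)\<close>.  Only polynomially many pairs of a block and a strip are involved, so a large
  fixed \<open>p\<close> makes the exceptional probability \<open>O(1 / w)\<close> (\<open>exceptional_set\<close>).  Outside the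
  exceptional set the recursion gives \<open>card A \<le> (K + 1) * w ^ (K\<^sup>2 + 5 * K)\<close>.  For a horizon
  \<open>n\<close> near \<open>w ^ (2 * K\<^sup>2)\<close> the exponent of \<open>n\<close> is \<open>1 / 2 + 5 / (2 * K)\<close>, which is below
  \<open>1 / 2 + \<epsilon>\<close> when \<open>K\<close> is large.
\<close>

section \<open>Increasing sets and nested time blocks\<close>

lemma sum_increments_le:
  fixes lo hi :: "nat \<Rightarrow> real"
  assumes "finite P" "P \<noteq> {}"
    and "\<And>i j. i \<in> P \<Longrightarrow> j \<in> P \<Longrightarrow> i < j \<Longrightarrow> hi i \<le> lo j"
  shows "(\<Sum>i\<in>P. hi i - lo i) \<le> hi (Max P) - lo (Min P)"
  using assms
proof (induction P rule: finite_linorder_max_induct)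
  case empty
  then show ?case by simp
next
  case (insert b P)
  show ?case
  proof (cases "P = {}")
    case True
    then show ?thesis by simp
  next
    case False
    have "(\<Sum>i\<in>P. hi i - lo i) \<le> hi (Max P) - lo (Min P)"
      using insert False by auto
    moreover have "hi (Max P) \<le> lo b"
      using insert False by (intro insert.prems) auto
    moreover have "Max (insert b P) = b"
      using insert False by (intro Max_eqI) auto
    moreover have "Min (insert b P) = Min P"
      proof (rule Min_eqI)
      have "Min P \<in> P" using insert(1) False by (rule Min_in)
      then show "Min P \<in> insert b P" by simp
      show "Min P \<le> y" if "y \<in> insert b P" for y
      proof (cases "y = b")
        case True
        then show ?thesis using insert(2) \<open>Min P \<in> P\<close> by (auto intro: less_imp_le)
      next
        case False
        then show ?thesis using that insert(1) by (auto intro: Min_le)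
      qed
    qed (use insert(1) in simp)
    moreover have "(\<Sum>i\<in>insert b P. hi i - lo i) = hi b - lo b + (\<Sum>i\<in>P. hi i - lo i)"
      using insert(1,2) by (intro sum.insert) auto
    ultimately show ?thesis by simp
  qed
qed

text \<open>
  The bound \<open>card (C i) \<le> q + b * (hi i - lo i) / \<delta>\<close> for the number of visited pieces of block \<open>i\<close>
  covers both kinds of blocks: the first term suffices if the increase \<open>hi i - lo i\<close> is at most \<open>\<delta>\<close>,
  and the second one is at least \<open>b\<close> otherwise.  Summed over all blocks, the increases telescope.
\<close>

lemma card_blocks_refine:
  fixes S :: "nat \<Rightarrow> real" and A :: "nat set" and \<delta> V :: real and b m q :: nat
  defines "P \<equiv> (\<lambda>t. t div (b * m)) ` A"
  assumes fin: "finite A" and mono: "mono_on A S" and pos: "0 < b" "0 < m" "0 < \<delta>" "0 \<le> V"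
    and range: "\<And>t u. t \<in> A \<Longrightarrow> u \<in> A \<Longrightarrow> S t - S u \<le> V"
    and strip: "\<And>i x. i \<in> P \<Longrightarrow>
      card {c. c < b \<and> (\<exists>t\<in>A. t div m = i * b + c \<and> S t \<in> {x..x + \<delta>})} \<le> q"
  shows "real (card ((\<lambda>t. t div m) ` A)) \<le> real q * real (card P) + real b * V / \<delta>"
proof (cases "A = {}")
  case True
  then show ?thesis using pos by (simp add: P_def)
next
  case False
  define B where "B = (\<lambda>i. {t\<in>A. t div (b * m) = i})"
  define lo where "lo = (\<lambda>i. S (Min (B i)))"
  define hi where "hi = (\<lambda>i. S (Max (B i)))"
  define C where "C = (\<lambda>i. {c. c < b \<and> (\<exists>t\<in>A. t div m = i * b + c)})"
  have finP: "finite P" and P_ne: "P \<noteq> {}" using fin False by (auto simp: P_def)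
  have finB: "finite (B i)" for i using fin by (simp add: B_def)
  have B_ne: "B i \<noteq> {}" if "i \<in> P" for i using that by (auto simp: B_def P_def)
  have Min_in: "Min (B i) \<in> B i" and Max_in: "Max (B i) \<in> B i" if "i \<in> P" for i
    using finB B_ne[OF that] by auto
  have BA: "t \<in> A" if "t \<in> B i" for t i using that by (simp add: B_def)
  have S_le: "S t \<le> S u" if "t \<in> A" "u \<in> A" "t \<le> u" for t u
    using mono that by (auto simp: mono_on_def)
  have lo_le: "lo i \<le> S t" and le_hi: "S t \<le> hi i" if "t \<in> B i" "i \<in> P" for t i
    unfolding lo_def hi_def using finB that(1) BA[OF Min_in[OF that(2)]] BA[OF Max_in[OF that(2)]]
    by (auto intro!: S_le intro: BA)
  have lohi: "lo i \<le> hi i" if "i \<in> P" for i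
    using le_hi[OF Min_in[OF that] that] by (simp add: lo_def)
  have order: "hi i \<le> lo j" if "i \<in> P" "j \<in> P" "i < j" for i j
    unfolding hi_def lo_def
  proof (rule S_le)
    have "Max (B i) div (b * m) = i" "Min (B j) div (b * m) = j"
      using Max_in[of i] Min_in[of j] that by (auto simp: B_def)
    then show "Max (B i) \<le> Min (B j)"
      using \<open>i < j\<close> by (metis div_le_mono linorder_not_le order_less_imp_le)
  qed (use that Max_in Min_in BA in blast)+
  have "(\<Sum>i\<in>P. hi i - lo i) \<le> hi (Max P) - lo (Min P)"
    using finP P_ne order by (rule sum_increments_le)
  also have "\<dots> \<le> V"
    unfolding hi_def lo_def using finP P_ne by (intro range BA[OF Max_in] BA[OF Min_in]) auto
  finally have sum_le: "(\<Sum>i\<in>P. hi i - lo i) \<le> V" .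
  have card_C: "real (card (C i)) \<le> real q + real b * (hi i - lo i) / \<delta>" if "i \<in> P" for i
  proof (cases "hi i - lo i \<le> \<delta>")
    case True
    have "S t \<in> {lo i..lo i + \<delta>}" if "t \<in> A" "t div m = i * b + c" "c < b" for t c
    proof -
      have "t div (b * m) = t div m div b" by (subst mult.commute) (rule div_mult2_eq)
      also have "\<dots> = i" using that by simp
      finally have "t \<in> B i" using that by (simp add: B_def)
      then show ?thesis using lo_le le_hi \<open>i \<in> P\<close> True by fastforce
    qed
    then have "C i \<subseteq> {c. c < b \<and> (\<exists>t\<in>A. t div m = i * b + c \<and> S t \<in> {lo i..lo i + \<delta>})}"
      unfolding C_def by blast
    then have "card (C i) \<le> card {c. c < b \<and> (\<exists>t\<in>A. t div m = i * b + c \<and> S t \<in> {lo i..lo i + \<delta>})}"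
      by (intro card_mono) auto
    also have "\<dots> \<le> q" using strip[OF that] .
    finally have "real (card (C i)) \<le> real q" by simp
    moreover have "0 \<le> real b * (hi i - lo i) / \<delta>" using lohi[OF that] pos by simp
    ultimately show ?thesis by linarith
  next
    case False
    have "card (C i) \<le> card {..<b}" by (intro card_mono) (auto simp: C_def)
    then have "real (card (C i)) \<le> real b * 1" by simp
    also have "\<dots> \<le> real b * ((hi i - lo i) / \<delta>)"
      using False pos by (intro mult_left_mono) auto
    finally show ?thesis by simp
  qed
  have "(\<lambda>t. t div m) ` A \<subseteq> (\<Union>i\<in>P. (\<lambda>c. i * b + c) ` C i)"
  proof
    fix k assume "k \<in> (\<lambda>t. t div m) ` A"
    then obtain t where t: "t \<in> A" "k = t div m" by blast
    have "t div (b * m) = k div b" unfolding t by (subst mult.commute) (rule div_mult2_eq)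
    then have "k div b \<in> P" using t by (force simp: P_def)
    moreover have "k mod b \<in> C (k div b)" using t pos by (auto simp: C_def)
    moreover have "k = k div b * b + k mod b" by simp
    ultimately show "k \<in> (\<Union>i\<in>P. (\<lambda>c. i * b + c) ` C i)" by blast
  qed
  then have "card ((\<lambda>t. t div m) ` A) \<le> card (\<Union>i\<in>P. (\<lambda>c. i * b + c) ` C i)"
    using finP by (intro card_mono) (auto simp: C_def)
  also have "\<dots> \<le> (\<Sum>i\<in>P. card ((\<lambda>c. i * b + c) ` C i))"
    using finP by (rule card_UN_le)
  also have "\<dots> \<le> (\<Sum>i\<in>P. card (C i))"
    by (intro sum_mono card_image_le) (auto simp: C_def)
  finally have "real (card ((\<lambda>t. t div m) ` A)) \<le> (\<Sum>i\<in>P. real (card (C i)))"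
    by (metis of_nat_le_iff of_nat_sum)
  also have "\<dots> \<le> (\<Sum>i\<in>P. real q + real b * (hi i - lo i) / \<delta>)"
    by (intro sum_mono card_C)
  also have "\<dots> = real q * real (card P) + real b * (\<Sum>i\<in>P. hi i - lo i) / \<delta>"
    by (simp add: sum.distrib sum_divide_distrib sum_distrib_left mult.commute)
  also have "\<dots> \<le> real q * real (card P) + real b * V / \<delta>"
    using sum_le pos by (intro add_left_mono divide_right_mono mult_left_mono) auto
  finally show ?thesis .
qed

text \<open>
  Iterating the refinement \<open>K\<close> times leads from one block of length \<open>s ^ (2 * K)\<close> to single points.
  At each level the contribution of the steep blocks is within \<open>s ^ 4 * Q ^ (K - j)\<close>, the size that
  the other term has as well, so the levels contribute comparable amounts and only a factor \<open>K + 1\<close>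
  is lost.
\<close>

lemma increasing_card_le:
  fixes S :: "nat \<Rightarrow> real" and s w K :: nat
  assumes A: "A \<subseteq> {..<s ^ (2 * K)}" and mono: "mono_on A S" and pos: "1 \<le> s" "1 \<le> w"
    and range: "\<And>t u. t < s ^ (2 * K) \<Longrightarrow> u < s ^ (2 * K) \<Longrightarrow> S t - S u \<le> real s ^ (K + 2)"
    and strip: "\<And>j i x. j < K \<Longrightarrow> i < s ^ (2 * (K - 1 - j)) \<Longrightarrow>
      card {c. c < s\<^sup>2 \<and> (\<exists>t. t div s ^ (2 * j) = i * s\<^sup>2 + c \<and> S t \<in> {x..x + real s ^ j})} \<le> s * w"
  shows "real (card A) \<le> real (K + 1) * real s ^ 4 * real (s * w) ^ K"
proof -
  have fin: "finite A" using A finite_subset by blast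
  define N where "N = (\<lambda>j. real (card ((\<lambda>t. t div s ^ (2 * j)) ` A)))"
  define Q where "Q = real (s * w)"
  have s1: "1 \<le> real s" and Q1: "1 \<le> Q" and sQ: "real s \<le> Q"
    using pos by (auto simp: Q_def simp flip: of_nat_mult)
  have step: "N j \<le> Q * N (Suc j) + real s ^ 4 * Q ^ (K - j)" if j: "j < K" for j
  proof -
    have split: "s\<^sup>2 * s ^ (2 * j) = s ^ (2 * Suc j)" by (simp add: power_add power2_eq_square)
    have "real (card ((\<lambda>t. t div s ^ (2 * j)) ` A)) \<le> real (s * w) *
        real (card ((\<lambda>t. t div (s\<^sup>2 * s ^ (2 * j))) ` A)) + real (s\<^sup>2) * real s ^ (K + 2) / real s ^ j"
    proof (rule card_blocks_refine[OF fin mono])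
      fix i x
      assume "i \<in> (\<lambda>t. t div (s\<^sup>2 * s ^ (2 * j))) ` A"
      then obtain t where t: "t \<in> A" "i = t div s ^ (2 * Suc j)" unfolding split by blast
      have "2 * K = 2 * (K - 1 - j) + 2 * Suc j"
        using j by simp
      then have "s ^ (2 * K) = s ^ (2 * (K - 1 - j)) * s ^ (2 * Suc j)"
        by (simp only: power_add)
      then have i: "i < s ^ (2 * (K - 1 - j))"
        using t A by (auto simp: less_mult_imp_div_less)
      have "card {c. c < s\<^sup>2 \<and> (\<exists>t\<in>A. t div s ^ (2 * j) = i * s\<^sup>2 + c \<and> S t \<in> {x..x + real s ^ j})}
        \<le> card {c. c < s\<^sup>2 \<and> (\<exists>t. t div s ^ (2 * j) = i * s\<^sup>2 + c \<and> S t \<in> {x..x + real s ^ j})}"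
        by (intro card_mono) auto
      also have "\<dots> \<le> s * w" using strip[OF j i] .
      finally show "card {c. c < s\<^sup>2 \<and> (\<exists>t\<in>A. t div s ^ (2 * j) = i * s\<^sup>2 + c \<and>
        S t \<in> {x..x + real s ^ j})} \<le> s * w" .
    next
      show "S t - S u \<le> real s ^ (K + 2)" if "t \<in> A" "u \<in> A" for t u
        using that A by (intro range) auto
    qed (use pos in auto)
    also have "real (s\<^sup>2) * real s ^ (K + 2) / real s ^ j = real s ^ 4 * real s ^ (K - j)"
    proof -
      have "K = (K - j) + j" using j by simp
      then have "real s ^ K = real s ^ (K - j) * real s ^ j" by (metis power_add)
      then show ?thesis using s1 by (simp add: power_add field_simps power2_eq_square eval_nat_numeral)
    qed
    also have "\<dots> \<le> real s ^ 4 * Q ^ (K - j)"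
      using s1 sQ by (intro mult_left_mono power_mono) auto
    finally show ?thesis unfolding N_def Q_def split by simp
  qed
  have "N (K - i) \<le> real (i + 1) * real s ^ 4 * Q ^ i" if "i \<le> K" for i
    using that
  proof (induction i)
    case 0
    have "(\<lambda>t. t div s ^ (2 * K)) ` A \<subseteq> {0}" using A by auto
    then have "card ((\<lambda>t. t div s ^ (2 * K)) ` A) \<le> card {0::nat}" by (intro card_mono) auto
    then have "N K \<le> 1" by (simp add: N_def)
    also have "1 \<le> real s ^ 4" using s1 by simp
    finally show ?case by simp
  next
    case (Suc i)
    have idx: "Suc (K - Suc i) = K - i" "K - (K - Suc i) = Suc i" using Suc by auto
    have "N (K - Suc i) \<le> Q * N (K - i) + real s ^ 4 * Q ^ Suc i"
    proof -
      have "K - Suc i < K" using Suc.prems by simp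
      from step[OF this] show ?thesis unfolding idx .
    qed
    also have "Q * N (K - i) \<le> Q * (real (i + 1) * real s ^ 4 * Q ^ i)"
    proof (rule mult_left_mono)
      show "N (K - i) \<le> real (i + 1) * real s ^ 4 * Q ^ i"
        using Suc.prems by (intro Suc.IH) simp
      show "0 \<le> Q" using Q1 by linarith
    qed
    also have "Q * (real (i + 1) * real s ^ 4 * Q ^ i) + real s ^ 4 * Q ^ Suc i
        = real (Suc i + 1) * real s ^ 4 * Q ^ Suc i"
      by (simp add: distrib_left distrib_right)
    finally show ?case by simp
  qed
  from this[OF order_refl] have "N 0 \<le> real (K + 1) * real s ^ 4 * Q ^ K" by simp
  moreover have "N 0 = real (card A)" by (simp add: N_def)
  ultimately show ?thesis unfolding Q_def by simp
qed

section \<open>Random walks driven by streams of steps\<close>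

definition walk :: "real \<Rightarrow> real stream \<Rightarrow> nat \<Rightarrow> real" where
  "walk y \<omega> t = y + (\<Sum>i<t. \<omega> !! i)"

lemma walk_0 [simp]: "walk y \<omega> 0 = y"
  by (simp add: walk_def)

lemma walk_Stream_Suc [simp]: "walk y (x ## \<omega>) (Suc t) = walk (y + x) \<omega> t"
  by (simp add: walk_def sum.lessThan_Suc_shift del: sum.lessThan_Suc)

text \<open>Together with the independence of the first steps from the later ones, this is the Markov property.\<close>

lemma walk_sdrop: "walk (walk y \<omega> m) (sdrop m \<omega>) t = walk y \<omega> (m + t)"
  by (induction t) (simp_all add: walk_def sdrop_snth add.commute)

lemma walk_stake_shift: "t \<le> m \<Longrightarrow> walk y (stake m \<omega> @- \<omega>') t = walk y \<omega> t"
  by (auto simp: walk_def shift_snth_less intro!: sum.cong)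

lemma walk_translate: "walk (y + c) \<omega> t = walk y \<omega> t + c"
  by (simp add: walk_def)

lemma borel_measurable_of_bool_pred [measurable (raw)]:
  "Measurable.pred M P \<Longrightarrow> (\<lambda>x. of_bool (P x) :: ennreal) \<in> borel_measurable M"
  by (simp add: of_bool_def)

definition hit :: "real set \<Rightarrow> nat \<Rightarrow> real \<Rightarrow> real stream \<Rightarrow> bool" where
  "hit D m y \<omega> \<longleftrightarrow> (\<exists>t<m. walk y \<omega> t \<in> D)"

primrec hit_blocks :: "real set \<Rightarrow> nat \<Rightarrow> nat \<Rightarrow> real \<Rightarrow> real stream \<Rightarrow> nat" where
  "hit_blocks D m 0 y \<omega> = 0"
| "hit_blocks D m (Suc r) y \<omega> =
    of_bool (hit D m y \<omega>) + hit_blocks D m r (walk y \<omega> m) (sdrop m \<omega>)"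

lemma card_less_Suc_shift:
  "card {c. c < Suc r \<and> Q c} = of_bool (Q 0) + card {c. c < r \<and> Q (Suc c)}"
proof -
  have "c \<in> {c. c < Suc r \<and> Q c} \<longleftrightarrow> c \<in> {c. c = 0 \<and> Q 0} \<union> Suc ` {c. c < r \<and> Q (Suc c)}" for c
    by (cases c) auto
  then have "{c. c < Suc r \<and> Q c} = {c. c = 0 \<and> Q 0} \<union> Suc ` {c. c < r \<and> Q (Suc c)}"
    by blast
  also have "card \<dots> = card {c::nat. c = 0 \<and> Q 0} + card (Suc ` {c. c < r \<and> Q (Suc c)})"
    by (intro card_Un_disjoint) auto
  also have "card {c::nat. c = 0 \<and> Q 0} = of_bool (Q 0)"
    by simp
  also have "card (Suc ` {c. c < r \<and> Q (Suc c)}) = card {c. c < r \<and> Q (Suc c)}"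
    by (simp add: card_image)
  finally show ?thesis .
qed

text \<open>
  The recursive definition peels off the first block, as the Markov property requires; the
  cardinality is the quantity that occurs in the covering argument.
\<close>

lemma hit_blocks_eq_card:
  "hit_blocks D m r y \<omega> = card {c. c < r \<and> (\<exists>t<m. walk y \<omega> (c * m + t) \<in> D)}"
proof (induction r arbitrary: y \<omega>)
  case 0
  then show ?case by simp
next
  case (Suc r)
  have shift: "walk (walk y \<omega> m) (sdrop m \<omega>) (c * m + t) = walk y \<omega> (Suc c * m + t)" for c t
    by (simp add: walk_sdrop add.assoc)
  show ?case
    unfolding card_less_Suc_shift by (simp only: hit_blocks.simps Suc.IH shift) (simp add: hit_def)
qed

text \<open>
  The law of the walk is the distribution of \<open>walk y\<close> under the product measure on streams, for
  which conditioning on the first steps is literally an iterated integral.  All probabilities below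
  are nonnegative integrals over streams and are estimated by induction on the number of steps,
  simultaneously for all starting points \<open>y\<close>.
\<close>

locale centered_walk = prob_space \<mu> for \<mu> :: "real measure" +
  fixes v :: real
  assumes sets_mu [measurable_cong, simp]: "sets \<mu> = sets borel"
    and integrable_step: "integrable \<mu> (\<lambda>x. x)"
    and integrable_square: "integrable \<mu> (\<lambda>x. x\<^sup>2)"
    and mean: "(\<integral>x. x \<partial>\<mu>) = 0"
    and second_moment: "(\<integral>x. x\<^sup>2 \<partial>\<mu>) = v"
    and v_pos: "0 < v"
begin

abbreviation \<Omega> :: "real stream measure" where "\<Omega> \<equiv> stream_space \<mu>"

sublocale \<Omega>: prob_space \<Omega>
  by (rule prob_space_stream_space)

lemma space_mu [simp]: "space \<mu> = UNIV"
  using sets_eq_imp_space_eq[OF sets_mu] by simp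

lemma space_\<Omega> [simp]: "space \<Omega> = UNIV"
  by (simp add: space_stream_space)

lemma emeasure_UNIV_\<Omega> [simp]: "emeasure \<Omega> UNIV = 1"
  using \<Omega>.emeasure_space_1 by simp

lemma measurable_snth_real [measurable (raw)]:
  assumes "f \<in> measurable N \<Omega>"
  shows "(\<lambda>x. f x !! i) \<in> borel_measurable N"
proof -
  have "(\<lambda>\<omega>. \<omega> !! i) \<in> borel_measurable \<Omega>"
    using measurable_snth[of i \<mu>] by (simp cong: measurable_cong_sets)
  then show ?thesis using assms by (rule measurable_compose[rotated])
qed

lemma measurable_walk [measurable (raw)]:
  assumes [measurable]: "f \<in> borel_measurable N" "g \<in> measurable N \<Omega>"
  shows "(\<lambda>x. walk (f x) (g x) t) \<in> borel_measurable N"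
  unfolding walk_def by measurable

lemma measurable_hit [measurable (raw)]:
  assumes [measurable]: "D \<in> sets borel" "f \<in> borel_measurable N" "g \<in> measurable N \<Omega>"
  shows "Measurable.pred N (\<lambda>x. hit D m (f x) (g x))"
  unfolding hit_def by measurable

lemma measurable_sdrop_compose [measurable (raw)]:
  "g \<in> measurable N \<Omega> \<Longrightarrow> (\<lambda>x. sdrop m (g x)) \<in> measurable N \<Omega>"
  by (rule measurable_compose[OF _ measurable_sdrop])

lemma measurable_hit_blocks [measurable (raw)]:
  assumes D: "D \<in> sets borel" and "f \<in> borel_measurable N" "g \<in> measurable N \<Omega>"
  shows "(\<lambda>x. hit_blocks D m r (f x) (g x)) \<in> measurable N (count_space UNIV)"
  using assms(2,3)
proof (induction r arbitrary: f g)
  case (Suc r)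
  note [measurable] = Suc.prems D Suc.IH
  show ?case unfolding hit_blocks.simps of_bool_def by measurable
qed simp

text \<open>The first \<open>m\<close> steps and the later ones are independent, and the later ones again form a stream with law \<open>\<Omega>\<close>.\<close>

lemma nn_integral_stake:
  assumes "f \<in> borel_measurable \<Omega>"
  shows "(\<integral>\<^sup>+\<omega>. f \<omega> \<partial>\<Omega>) = (\<integral>\<^sup>+\<omega>. \<integral>\<^sup>+\<omega>'. f (stake m \<omega> @- \<omega>') \<partial>\<Omega> \<partial>\<Omega>)"
  using assms
proof (induction m arbitrary: f)
  case 0
  then show ?case by simp
next
  case (Suc m)
  note [measurable] = Suc.prems
  have "(\<integral>\<^sup>+\<omega>. f \<omega> \<partial>\<Omega>) = (\<integral>\<^sup>+x. \<integral>\<^sup>+\<omega>. f (x ## \<omega>) \<partial>\<Omega> \<partial>\<mu>)"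
    by (rule nn_integral_stream_space) measurable
  also have "\<dots> = (\<integral>\<^sup>+x. \<integral>\<^sup>+\<omega>. \<integral>\<^sup>+\<omega>'. f (x ## (stake m \<omega> @- \<omega>')) \<partial>\<Omega> \<partial>\<Omega> \<partial>\<mu>)"
    by (intro nn_integral_cong Suc.IH) measurable
  also have "\<dots> = (\<integral>\<^sup>+x. \<integral>\<^sup>+\<omega>. \<integral>\<^sup>+\<omega>'. f (stake (Suc m) (x ## \<omega>) @- \<omega>') \<partial>\<Omega> \<partial>\<Omega> \<partial>\<mu>)"
    by simp
  also have "\<dots> = (\<integral>\<^sup>+\<omega>. \<integral>\<^sup>+\<omega>'. f (stake (Suc m) \<omega> @- \<omega>') \<partial>\<Omega> \<partial>\<Omega>)"
    by (rule nn_integral_stream_space[symmetric]) measurable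
  finally show ?case .
qed

lemma nn_integral_markov:
  assumes [measurable]: "case_prod F \<in> borel_measurable (borel \<Otimes>\<^sub>M \<Omega>)"
  shows "(\<integral>\<^sup>+\<omega>. F (walk y \<omega> m) (sdrop m \<omega>) \<partial>\<Omega>) = (\<integral>\<^sup>+\<omega>. \<integral>\<^sup>+\<omega>'. F (walk y \<omega> m) \<omega>' \<partial>\<Omega> \<partial>\<Omega>)"
proof -
  have "(\<integral>\<^sup>+\<omega>. F (walk y \<omega> m) (sdrop m \<omega>) \<partial>\<Omega>) =
    (\<integral>\<^sup>+\<omega>. \<integral>\<^sup>+\<omega>'. F (walk y (stake m \<omega> @- \<omega>') m) (sdrop m (stake m \<omega> @- \<omega>')) \<partial>\<Omega> \<partial>\<Omega>)"
    by (rule nn_integral_stake) measurable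
  then show ?thesis by (simp add: walk_stake_shift sdrop_shift)
qed

lemma nn_integral_sdrop:
  assumes "f \<in> borel_measurable \<Omega>"
  shows "(\<integral>\<^sup>+\<omega>. f (sdrop m \<omega>) \<partial>\<Omega>) = (\<integral>\<^sup>+\<omega>. f \<omega> \<partial>\<Omega>)"
  using nn_integral_markov[of "\<lambda>_. f" 0 m] assms
  by simp

text \<open>The constant \<open>c\<close> stands for the variance of the remaining steps in inductions on the horizon.\<close>

lemma nn_integral_step_square:
  assumes "0 \<le> c"
  shows "(\<integral>\<^sup>+x. ennreal ((y + x)\<^sup>2 + c) \<partial>\<mu>) = ennreal (y\<^sup>2 + v + c)"
proof -
  have eq: "(y + x)\<^sup>2 + c = (y\<^sup>2 + c) + (2 * y * x + x\<^sup>2)" for x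
    by (simp add: power2_eq_square algebra_simps)
  have "(\<integral>\<^sup>+x. ennreal ((y + x)\<^sup>2 + c) \<partial>\<mu>) = ennreal (\<integral>x. (y + x)\<^sup>2 + c \<partial>\<mu>)"
    unfolding eq using assms integrable_step integrable_square
    by (intro nn_integral_eq_integral Bochner_Integration.integrable_add integrable_mult_right)
       (auto simp flip: eq)
  also have "(\<integral>x. (y + x)\<^sup>2 + c \<partial>\<mu>) = y\<^sup>2 + c + v"
    unfolding eq using integrable_step integrable_square
    by (simp add: prob_space[simplified] mean second_moment)
  finally show ?thesis by (simp add: algebra_simps)
qed

lemma nn_integral_walk_square:
  "(\<integral>\<^sup>+\<omega>. ennreal ((walk y \<omega> n)\<^sup>2) \<partial>\<Omega>) = ennreal (y\<^sup>2 + n * v)"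
proof (induction n arbitrary: y)
  case 0
  then show ?case by simp
next
  case (Suc n)
  have "(\<integral>\<^sup>+\<omega>. ennreal ((walk y \<omega> (Suc n))\<^sup>2) \<partial>\<Omega>) =
      (\<integral>\<^sup>+x. \<integral>\<^sup>+\<omega>. ennreal ((walk y (x ## \<omega>) (Suc n))\<^sup>2) \<partial>\<Omega> \<partial>\<mu>)"
    by (rule nn_integral_stream_space) measurable
  also have "\<dots> = (\<integral>\<^sup>+x. ennreal ((y + x)\<^sup>2 + n * v) \<partial>\<mu>)"
    by (simp add: Suc.IH)
  also have "\<dots> = ennreal (y\<^sup>2 + v + n * v)"
    using v_pos by (intro nn_integral_step_square) simp
  finally show ?case by (simp add: algebra_simps)
qed

text \<open>
  Kolmogorov's inequality.  The bound \<open>(y\<^sup>2 + n * v) / a\<^sup>2\<close> is trivial when \<open>a \<le> \<bar>y\<bar>\<close>,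
  and its mean after one step from \<open>y\<close> with horizon \<open>n\<close> is its value at \<open>y\<close> with horizon \<open>n + 1\<close>.
\<close>

lemma maximal_inequality:
  fixes n :: nat
  assumes a: "0 < a"
  shows "(\<integral>\<^sup>+\<omega>. of_bool (\<exists>t\<le>n. a \<le> \<bar>walk y \<omega> t\<bar>) \<partial>\<Omega>) \<le> ennreal ((y\<^sup>2 + n * v) / a\<^sup>2)"
proof (induction n arbitrary: y)
  case 0
  have "1 \<le> ennreal (y\<^sup>2 / a\<^sup>2)" if "a \<le> \<bar>y\<bar>"
  proof -
    have "a\<^sup>2 \<le> y\<^sup>2" using a that by (simp add: abs_le_square_iff[symmetric])
    then have "ennreal 1 \<le> ennreal (y\<^sup>2 / a\<^sup>2)" using a by (intro ennreal_leI) (simp add: le_divide_eq)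
    then show ?thesis by simp
  qed
  then show ?case by (cases "a \<le> \<bar>y\<bar>") simp_all
next
  case (Suc n)
  show ?case
  proof (cases "a \<le> \<bar>y\<bar>")
    case True
    have "(\<integral>\<^sup>+\<omega>. of_bool (\<exists>t\<le>Suc n. a \<le> \<bar>walk y \<omega> t\<bar>) \<partial>\<Omega>) \<le> (\<integral>\<^sup>+\<omega>. 1 \<partial>\<Omega>)"
      by (intro nn_integral_mono) auto
    also have "\<dots> = ennreal 1" by simp
    also have "\<dots> \<le> ennreal ((y\<^sup>2 + Suc n * v) / a\<^sup>2)"
    proof (rule ennreal_leI)
      have "a\<^sup>2 \<le> y\<^sup>2" using True a by (simp add: abs_le_square_iff[symmetric])
      moreover have "0 \<le> Suc n * v" using v_pos by simp
      ultimately show "1 \<le> (y\<^sup>2 + Suc n * v) / a\<^sup>2" using a by (simp add: field_simps)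
    qed
    finally show ?thesis .
  next
    case False
    have ex: "(\<exists>t\<le>Suc n. a \<le> \<bar>walk y (x ## \<omega>) t\<bar>) \<longleftrightarrow> (\<exists>t\<le>n. a \<le> \<bar>walk (y + x) \<omega> t\<bar>)" for x \<omega>
    proof
      assume "\<exists>t\<le>Suc n. a \<le> \<bar>walk y (x ## \<omega>) t\<bar>"
      then obtain t where "t \<le> Suc n" "a \<le> \<bar>walk y (x ## \<omega>) t\<bar>" by blast
      then show "\<exists>t\<le>n. a \<le> \<bar>walk (y + x) \<omega> t\<bar>" using False by (cases t) auto
    next
      assume "\<exists>t\<le>n. a \<le> \<bar>walk (y + x) \<omega> t\<bar>"
      then obtain t where "t \<le> n" "a \<le> \<bar>walk (y + x) \<omega> t\<bar>" by blast
      then show "\<exists>t\<le>Suc n. a \<le> \<bar>walk y (x ## \<omega>) t\<bar>" by (intro exI[of _ "Suc t"]) simp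
    qed
    have "(\<integral>\<^sup>+\<omega>. of_bool (\<exists>t\<le>Suc n. a \<le> \<bar>walk y \<omega> t\<bar>) \<partial>\<Omega>) =
        (\<integral>\<^sup>+x. \<integral>\<^sup>+\<omega>. of_bool (\<exists>t\<le>Suc n. a \<le> \<bar>walk y (x ## \<omega>) t\<bar>) \<partial>\<Omega> \<partial>\<mu>)"
      by (rule nn_integral_stream_space) measurable
    also have "\<dots> \<le> (\<integral>\<^sup>+x. ennreal (((y + x)\<^sup>2 + n * v) / a\<^sup>2) \<partial>\<mu>)"
      unfolding ex by (intro nn_integral_mono Suc.IH)
    also have "\<dots> = (\<integral>\<^sup>+x. ennreal (1 / a\<^sup>2) * ennreal ((y + x)\<^sup>2 + n * v) \<partial>\<mu>)"
      using v_pos by (intro nn_integral_cong) (subst ennreal_mult[symmetric], auto)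
    also have "\<dots> = ennreal (1 / a\<^sup>2) * (\<integral>\<^sup>+x. ennreal ((y + x)\<^sup>2 + n * v) \<partial>\<mu>)"
      by (rule nn_integral_cmult) measurable
    also have "(\<integral>\<^sup>+x. ennreal ((y + x)\<^sup>2 + n * v) \<partial>\<mu>) = ennreal (y\<^sup>2 + v + n * v)"
      using v_pos by (intro nn_integral_step_square) simp
    also have "ennreal (1 / a\<^sup>2) * \<dots> = ennreal (1 / a\<^sup>2 * (y\<^sup>2 + v + n * v))"
      using v_pos by (intro ennreal_mult[symmetric]) auto
    also have "1 / a\<^sup>2 * (y\<^sup>2 + v + n * v) = (y\<^sup>2 + Suc n * v) / a\<^sup>2"
      by (simp add: algebra_simps add_divide_distrib)
    finally show ?thesis .
  qed
qed

end

section \<open>Occupation times of intervals\<close>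

text \<open>The Huber function is convex and quadratic near 0, but its slope \<open>2 * max (- R) (min R z)\<close> is bounded.\<close>

definition huber :: "real \<Rightarrow> real \<Rightarrow> real" where
  "huber R z = (if \<bar>z\<bar> \<le> R then z\<^sup>2 else 2 * R * \<bar>z\<bar> - R\<^sup>2)"

text \<open>
  \<open>huber R z\<close> is the maximum of \<open>2 * c * z - c\<^sup>2\<close> over \<open>\<bar>c\<bar> \<le> R\<close>.  This and the next lemma
  give its convexity and its Lipschitz bound without derivatives.
\<close>

lemma huber_ge_tangent:
  assumes "\<bar>c\<bar> \<le> R"
  shows "2 * c * z - c\<^sup>2 \<le> huber R z"
proof (cases "\<bar>z\<bar> \<le> R")
  case True
  have "0 \<le> (z - c)\<^sup>2" by simp
  then show ?thesis using True by (simp add: huber_def power2_eq_square algebra_simps)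
next
  case False
  have "c * z \<le> \<bar>c\<bar> * \<bar>z\<bar>" by (metis abs_mult abs_ge_self)
  moreover have "0 \<le> (R - \<bar>c\<bar>) * (2 * \<bar>z\<bar> - R - \<bar>c\<bar>)"
    using False assms by (intro mult_nonneg_nonneg) auto
  moreover have "c\<^sup>2 = \<bar>c\<bar> * \<bar>c\<bar>" by (simp add: power2_eq_square)
  ultimately show ?thesis using False
    by (simp add: huber_def power2_eq_square algebra_simps)
qed

lemma huber_eq_tangent:
  assumes "0 \<le> R"
  shows "huber R z = 2 * max (- R) (min R z) * z - (max (- R) (min R z))\<^sup>2"
proof -
  consider "z < - R" | "- R \<le> z" "z \<le> R" | "R < z" by linarith
  then show ?thesis
  proof cases
    case 1
    then have "max (- R) (min R z) = - R" "\<not> \<bar>z\<bar> \<le> R" "\<bar>z\<bar> = - z" using assms by auto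
    then show ?thesis by (simp add: huber_def)
  next
    case 2
    then have "max (- R) (min R z) = z" "\<bar>z\<bar> \<le> R" by auto
    then show ?thesis by (simp add: huber_def power2_eq_square)
  next
    case 3
    then have "max (- R) (min R z) = R" "\<not> \<bar>z\<bar> \<le> R" "\<bar>z\<bar> = z" using assms by auto
    then show ?thesis by (simp add: huber_def)
  qed
qed

lemma huber_nonneg: "0 \<le> R \<Longrightarrow> 0 \<le> huber R z"
  using huber_ge_tangent[of 0 R z] by simp

lemma huber_add_ge:
  assumes "0 \<le> R"
  shows "huber R z + 2 * max (- R) (min R z) * x + (if \<bar>z\<bar> \<le> R/2 \<and> \<bar>x\<bar> \<le> R/2 then x\<^sup>2 else 0)
    \<le> huber R (z + x)"
proof (cases "\<bar>z\<bar> \<le> R/2 \<and> \<bar>x\<bar> \<le> R/2")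
  case True
  then have "\<bar>z\<bar> \<le> R" "\<bar>z + x\<bar> \<le> R" "max (- R) (min R z) = z" by auto
  then show ?thesis using True by (simp add: huber_def power2_eq_square algebra_simps)
next
  case False
  have "\<bar>max (- R) (min R z)\<bar> \<le> R" using assms by auto
  from huber_ge_tangent[OF this, of "z + x"] show ?thesis
    unfolding huber_eq_tangent[OF assms, of z] using False by (simp only: if_False) (simp add: algebra_simps)
qed

lemma huber_add_le:
  assumes "0 \<le> R"
  shows "huber R (z + x) \<le> huber R z + 2 * R * \<bar>x\<bar>"
proof -
  define c where "c = max (- R) (min R (z + x))"
  have c: "\<bar>c\<bar> \<le> R" using assms by (auto simp: c_def)
  have "huber R (z + x) = 2 * c * (z + x) - c\<^sup>2"
    unfolding c_def by (rule huber_eq_tangent[OF assms])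
  also have "\<dots> = (2 * c * z - c\<^sup>2) + 2 * (c * x)" by (simp add: algebra_simps)
  also have "\<dots> \<le> huber R z + 2 * (R * \<bar>x\<bar>)"
  proof (intro add_mono mult_left_mono huber_ge_tangent[OF c])
    have "c * x \<le> \<bar>c\<bar> * \<bar>x\<bar>" by (metis abs_mult abs_ge_self)
    also have "\<dots> \<le> R * \<bar>x\<bar>" using c by (intro mult_right_mono) auto
    finally show "c * x \<le> R * \<bar>x\<bar>" .
  qed simp
  finally show ?thesis by simp
qed

lemma borel_measurable_huber [measurable (raw)]:
  assumes [measurable]: "f \<in> borel_measurable N"
  shows "(\<lambda>x. huber R (f x)) \<in> borel_measurable N"
  unfolding huber_def by measurable

lemma sum_lessThan_add:
  fixes f :: "nat \<Rightarrow> ennreal"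
  shows "(\<Sum>t<a + b. f t) = (\<Sum>t<a. f t) + (\<Sum>t<b. f (a + t))"
  by (induction b) (simp_all add: add.assoc)

lemma sum_overlapping_blocks_le:
  fixes f :: "nat \<Rightarrow> ennreal"
  shows "(\<Sum>j<r. \<Sum>t<2 * m. f (j * m + t)) \<le> 2 * (\<Sum>t<Suc r * m. f t)"
proof -
  have group: "(\<Sum>j<k. \<Sum>t<m. g (j * m + t)) = (\<Sum>t<k * m. g t)" for k and g :: "nat \<Rightarrow> ennreal"
  proof (induction k)
    case (Suc k)
    have "(\<Sum>t<Suc k * m. g t) = (\<Sum>t<k * m + m. g t)" by (simp add: add.commute)
    then show ?case unfolding sum_lessThan_add by (simp add: Suc)
  qed simp
  have "(\<Sum>j<r. \<Sum>t<2 * m. f (j * m + t)) =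
      (\<Sum>j<r. (\<Sum>t<m. f (j * m + t)) + (\<Sum>t<m. f (m + (j * m + t))))"
    unfolding mult_2 sum_lessThan_add by (simp add: add_ac)
  also have "\<dots> = (\<Sum>t<r * m. f t) + (\<Sum>t<r * m. f (m + t))"
    unfolding sum.distrib group[of f] group[of "\<lambda>t. f (m + t)"] ..
  also have "\<dots> \<le> (\<Sum>t<m + r * m. f t) + (\<Sum>t<m + r * m. f t)"
  proof (rule add_mono)
    show "(\<Sum>t<r * m. f t) \<le> (\<Sum>t<m + r * m. f t)" by (intro sum_mono2) auto
    show "(\<Sum>t<r * m. f (m + t)) \<le> (\<Sum>t<m + r * m. f t)" by (simp add: sum_lessThan_add)
  qed
  finally show ?thesis by (simp add: mult_2)
qed

context centered_walk
begin

text \<open>A truncation level that keeps half of the variance; larger steps may leave the quadratic region of \<open>huber\<close>.\<close>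

lemma exists_truncation:
  obtains T where "0 < T" "\<And>R. T \<le> R \<Longrightarrow> v / 2 \<le> (\<integral>x. (if \<bar>x\<bar> \<le> R then x\<^sup>2 else 0) \<partial>\<mu>)"
proof -
  have "(\<lambda>n. \<integral>x. (if \<bar>x\<bar> \<le> real n then x\<^sup>2 else 0) \<partial>\<mu>) \<longlonglongrightarrow> (\<integral>x. x\<^sup>2 \<partial>\<mu>)"
  proof (rule integral_dominated_convergence[where w="\<lambda>x. x\<^sup>2"])
    show "AE x in \<mu>. (\<lambda>n. if \<bar>x\<bar> \<le> real n then x\<^sup>2 else 0) \<longlonglongrightarrow> x\<^sup>2"
    proof (intro AE_I2 tendsto_eventually)
      fix x :: real
      show "\<forall>\<^sub>F n in sequentially. (if \<bar>x\<bar> \<le> real n then x\<^sup>2 else 0) = x\<^sup>2"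
        using eventually_ge_at_top[of "nat \<lceil>\<bar>x\<bar>\<rceil>"]
        by eventually_elim (simp add: nat_ceiling_le_eq)
    qed
  qed (use integrable_square in auto)
  then have "\<forall>\<^sub>F n in sequentially. v / 2 < (\<integral>x. (if \<bar>x\<bar> \<le> real n then x\<^sup>2 else 0) \<partial>\<mu>)"
    using v_pos by (intro order_tendstoD) (auto simp: second_moment)
  then obtain n where n: "v / 2 < (\<integral>x. (if \<bar>x\<bar> \<le> real n then x\<^sup>2 else 0) \<partial>\<mu>)"
    by (auto simp: eventually_sequentially)
  show thesis
  proof (rule that[of "real n + 1"])
    fix R assume R: "real n + 1 \<le> R"
    have int: "integrable \<mu> (\<lambda>x. if \<bar>x\<bar> \<le> c then x\<^sup>2 else 0)" for c :: real
      by (rule Bochner_Integration.integrable_bound[OF integrable_square]) auto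
    have "(\<integral>x. (if \<bar>x\<bar> \<le> real n then x\<^sup>2 else 0) \<partial>\<mu>) \<le> (\<integral>x. (if \<bar>x\<bar> \<le> R then x\<^sup>2 else 0) \<partial>\<mu>)"
      using R by (intro integral_mono int) auto
    then show "v / 2 \<le> (\<integral>x. (if \<bar>x\<bar> \<le> R then x\<^sup>2 else 0) \<partial>\<mu>)" using n by linarith
  qed simp
qed

text \<open>
  The linear term of \<open>huber_add_ge\<close> has mean zero, by convexity the rest is nonnegative, and for \<open>z\<close>
  in the inner half of the quadratic region it is at least the truncated second moment.
\<close>

lemma huber_drift:
  assumes R: "0 \<le> R" and trunc: "v / 2 \<le> (\<integral>x. (if \<bar>x\<bar> \<le> R/2 then x\<^sup>2 else 0) \<partial>\<mu>)"
  shows "ennreal (v / 2) * indicator {- (R/2)..R/2} z + ennreal (huber R z)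
    \<le> (\<integral>\<^sup>+x. ennreal (huber R (z + x)) \<partial>\<mu>)"
proof -
  define c where "c = max (- R) (min R z)"
  define g where "g = (\<lambda>x. huber R z + 2 * c * x + indicator {- (R/2)..R/2} z * (if \<bar>x\<bar> \<le> R/2 then x\<^sup>2 else 0))"
  have int: "integrable \<mu> (\<lambda>x. if \<bar>x\<bar> \<le> R/2 then x\<^sup>2 else 0)"
    by (rule Bochner_Integration.integrable_bound[OF integrable_square]) auto
  have g_int: "integrable \<mu> g"
    unfolding g_def using integrable_step int by auto
  have g_eq: "(\<integral>x. g x \<partial>\<mu>) =
      huber R z + indicator {- (R/2)..R/2} z * (\<integral>x. (if \<bar>x\<bar> \<le> R/2 then x\<^sup>2 else 0) \<partial>\<mu>)"
    unfolding g_def using integrable_step int by (simp add: prob_space[simplified] mean)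
  have g_le: "g x \<le> huber R (z + x)" for x
  proof -
    have ind: "indicator {- (R/2)..R/2} z = (if \<bar>z\<bar> \<le> R/2 then 1 else 0 :: real)"
      by (auto simp: indicator_def abs_le_iff)
    show ?thesis
      using huber_add_ge[OF R, of z x] unfolding g_def c_def[symmetric] ind
      by (cases "\<bar>z\<bar> \<le> R/2") simp_all
  qed
  have h_int: "integrable \<mu> (\<lambda>x. huber R (z + x))"
  proof (rule Bochner_Integration.integrable_bound)
    show "integrable \<mu> (\<lambda>x. huber R z + 2 * R * \<bar>x\<bar>)" using integrable_step by auto
    show "AE x in \<mu>. norm (huber R (z + x)) \<le> norm (huber R z + 2 * R * \<bar>x\<bar>)"
      using huber_add_le[OF R, of z] huber_nonneg[OF R] R by (intro AE_I2) (simp add: abs_of_nonneg)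
  qed measurable
  have "huber R z + indicator {- (R/2)..R/2} z * (v / 2) \<le> (\<integral>x. g x \<partial>\<mu>)"
    unfolding g_eq using trunc by (intro add_left_mono mult_left_mono) auto
  also have "\<dots> \<le> (\<integral>x. huber R (z + x) \<partial>\<mu>)"
    by (intro integral_mono g_int h_int g_le)
  finally have "ennreal (huber R z + indicator {- (R/2)..R/2} z * (v / 2)) \<le> ennreal (\<integral>x. huber R (z + x) \<partial>\<mu>)"
    by (rule ennreal_leI)
  also have "\<dots> = (\<integral>\<^sup>+x. ennreal (huber R (z + x)) \<partial>\<mu>)"
    by (intro nn_integral_eq_integral[symmetric] h_int AE_I2 huber_nonneg R)
  finally show ?thesis
    using huber_nonneg[OF R, of z] v_pos by (auto simp: ennreal_plus add.commute split: split_indicator)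
qed

text \<open>
  Each visit to the interval contributes \<open>v / 2\<close> to the expected growth of \<open>huber R\<close> along the walk:
  a one-sided version of Tanaka's formula for the local time.
\<close>

lemma occupation_le_huber:
  assumes R: "0 \<le> R" and trunc: "v / 2 \<le> (\<integral>x. (if \<bar>x\<bar> \<le> R/2 then x\<^sup>2 else 0) \<partial>\<mu>)"
  shows "ennreal (v / 2) * (\<integral>\<^sup>+\<omega>. (\<Sum>t<n. indicator {x - R/2..x + R/2} (walk y \<omega> t)) \<partial>\<Omega>)
      + ennreal (huber R (y - x)) \<le> (\<integral>\<^sup>+\<omega>. ennreal (huber R (walk y \<omega> n - x)) \<partial>\<Omega>)"
proof (induction n arbitrary: y)
  case 0
  then show ?case by simp
next
  case (Suc n)
  define D where "D = {x - R/2..x + R/2}"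
  have [measurable]: "D \<in> sets borel" by (simp add: D_def)
  define U where "U = (\<lambda>y. \<integral>\<^sup>+\<omega>. (\<Sum>t<n. indicator D (walk y \<omega> t)) \<partial>\<Omega>)"
  have [measurable]: "U \<in> borel_measurable borel" unfolding U_def by measurable
  have "(\<integral>\<^sup>+\<omega>. (\<Sum>t<Suc n. indicator D (walk y \<omega> t)) \<partial>\<Omega>) =
      (\<integral>\<^sup>+x'. \<integral>\<^sup>+\<omega>. (\<Sum>t<Suc n. indicator D (walk y (x' ## \<omega>) t)) \<partial>\<Omega> \<partial>\<mu>)"
    by (rule nn_integral_stream_space) measurable
  also have "\<dots> = (\<integral>\<^sup>+x'. \<integral>\<^sup>+\<omega>. indicator D y + (\<Sum>t<n. indicator D (walk (y + x') \<omega> t)) \<partial>\<Omega> \<partial>\<mu>)"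
    by (simp add: sum.lessThan_Suc_shift del: sum.lessThan_Suc)
  also have "\<dots> = (\<integral>\<^sup>+x'. indicator D y + U (y + x') \<partial>\<mu>)"
    unfolding U_def by (subst nn_integral_add) auto
  also have "\<dots> = indicator D y + (\<integral>\<^sup>+x'. U (y + x') \<partial>\<mu>)"
    by (subst nn_integral_add) (auto simp: emeasure_space_1[simplified])
  finally have occ: "(\<integral>\<^sup>+\<omega>. (\<Sum>t<Suc n. indicator D (walk y \<omega> t)) \<partial>\<Omega>) =
    indicator D y + (\<integral>\<^sup>+x'. U (y + x') \<partial>\<mu>)" .
  have ind: "indicator D y = (indicator {- (R/2)..R/2} (y - x) :: ennreal)"
    by (auto simp: D_def split: split_indicator)
  have "ennreal (v / 2) * (indicator D y + (\<integral>\<^sup>+x'. U (y + x') \<partial>\<mu>)) + ennreal (huber R (y - x))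
      = (ennreal (v / 2) * indicator {- (R/2)..R/2} (y - x) + ennreal (huber R (y - x)))
        + ennreal (v / 2) * (\<integral>\<^sup>+x'. U (y + x') \<partial>\<mu>)"
    unfolding ind by (simp add: distrib_left add_ac)
  also have "\<dots> \<le> (\<integral>\<^sup>+x'. ennreal (huber R ((y - x) + x')) \<partial>\<mu>) + ennreal (v / 2) * (\<integral>\<^sup>+x'. U (y + x') \<partial>\<mu>)"
    by (intro add_right_mono huber_drift R trunc)
  also have "\<dots> = (\<integral>\<^sup>+x'. ennreal (v / 2) * U (y + x') + ennreal (huber R (y + x' - x)) \<partial>\<mu>)"
  proof -
    have eq: "y + x' - x = (y - x) + x'" for x' by simp
    show ?thesis unfolding eq by (simp add: nn_integral_add nn_integral_cmult add.commute)
  qed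
  also have "\<dots> \<le> (\<integral>\<^sup>+x'. \<integral>\<^sup>+\<omega>. ennreal (huber R (walk (y + x') \<omega> n - x)) \<partial>\<Omega> \<partial>\<mu>)"
    unfolding U_def D_def by (intro nn_integral_mono Suc.IH)
  also have "\<dots> = (\<integral>\<^sup>+x'. \<integral>\<^sup>+\<omega>. ennreal (huber R (walk y (x' ## \<omega>) (Suc n) - x)) \<partial>\<Omega> \<partial>\<mu>)"
    by simp
  also have "\<dots> = (\<integral>\<^sup>+\<omega>. ennreal (huber R (walk y \<omega> (Suc n) - x)) \<partial>\<Omega>)"
    by (rule nn_integral_stream_space[symmetric]) measurable
  finally show ?case unfolding D_def[symmetric] occ .
qed

lemma nn_integral_walk_abs:
  "(\<integral>\<^sup>+\<omega>. ennreal \<bar>walk 0 \<omega> n\<bar> \<partial>\<Omega>) \<le> ennreal (sqrt (n * v))"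
proof (cases "n = 0")
  case False
  define a where "a = sqrt (n * v)"
  have a: "0 < a" "a\<^sup>2 = n * v" using False v_pos by (auto simp: a_def)
  have le: "\<bar>s\<bar> \<le> 1 / (2 * a) * (s\<^sup>2 + a\<^sup>2)" for s :: real
  proof -
    have "0 \<le> (\<bar>s\<bar> - a)\<^sup>2" by simp
    then show ?thesis using a(1) by (simp add: power2_eq_square field_simps)
  qed
  have "(\<integral>\<^sup>+\<omega>. ennreal \<bar>walk 0 \<omega> n\<bar> \<partial>\<Omega>) \<le>
      (\<integral>\<^sup>+\<omega>. ennreal (1 / (2 * a)) * (ennreal ((walk 0 \<omega> n)\<^sup>2) + ennreal (a\<^sup>2)) \<partial>\<Omega>)"
    using a(1) le by (intro nn_integral_mono)
      (simp add: ennreal_leI flip: ennreal_plus ennreal_mult)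
  also have "\<dots> = ennreal (1 / (2 * a)) * (ennreal (n * v) + ennreal (a\<^sup>2))"
    by (simp add: nn_integral_cmult nn_integral_add nn_integral_walk_square)
  also have "ennreal (n * v) + ennreal (a\<^sup>2) = ennreal (n * v + a\<^sup>2)"
    using v_pos by (intro ennreal_plus[symmetric]) auto
  also have "ennreal (1 / (2 * a)) * \<dots> = ennreal (1 / (2 * a) * (n * v + a\<^sup>2))"
    using a(1) v_pos by (intro ennreal_mult[symmetric]) auto
  also have "1 / (2 * a) * (n * v + a\<^sup>2) = a"
    unfolding a(2)[symmetric] using a(1) by (simp add: power2_eq_square)
  finally show ?thesis by (simp add: a_def)
qed simp

text \<open>
  The expected growth is at most the slope \<open>2 * R\<close> times the expected displacement.  So the time spent
  in an interval of length \<open>R\<close> up to time \<open>n\<close> is \<open>O(R * sqrt n)\<close>, uniformly in the starting point.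
\<close>

lemma occupation_bound:
  assumes R: "0 \<le> R" and trunc: "v / 2 \<le> (\<integral>x. (if \<bar>x\<bar> \<le> R/2 then x\<^sup>2 else 0) \<partial>\<mu>)"
  shows "ennreal (v / 2) * (\<integral>\<^sup>+\<omega>. (\<Sum>t<n. indicator {x - R/2..x + R/2} (walk y \<omega> t)) \<partial>\<Omega>)
    \<le> ennreal (2 * R * sqrt (n * v))"
proof -
  have "ennreal (v / 2) * (\<integral>\<^sup>+\<omega>. (\<Sum>t<n. indicator {x - R/2..x + R/2} (walk y \<omega> t)) \<partial>\<Omega>)
      + ennreal (huber R (y - x)) \<le> (\<integral>\<^sup>+\<omega>. ennreal (huber R (walk y \<omega> n - x)) \<partial>\<Omega>)"
    by (rule occupation_le_huber[OF R trunc])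
  also have "\<dots> \<le> (\<integral>\<^sup>+\<omega>. ennreal (huber R (y - x)) + ennreal (2 * R) * ennreal \<bar>walk 0 \<omega> n\<bar> \<partial>\<Omega>)"
  proof (rule nn_integral_mono)
    fix \<omega>
    have "walk y \<omega> n - x = (y - x) + walk 0 \<omega> n" by (simp add: walk_def)
    then have "huber R (walk y \<omega> n - x) \<le> huber R (y - x) + 2 * R * \<bar>walk 0 \<omega> n\<bar>"
      using huber_add_le[OF R, of "y - x" "walk 0 \<omega> n"] by (simp only:)
    then have "ennreal (huber R (walk y \<omega> n - x)) \<le> ennreal (huber R (y - x) + 2 * R * \<bar>walk 0 \<omega> n\<bar>)"
      by (rule ennreal_leI)
    then show "ennreal (huber R (walk y \<omega> n - x)) \<le> ennreal (huber R (y - x)) + ennreal (2 * R) * ennreal \<bar>walk 0 \<omega> n\<bar>"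
      using R huber_nonneg[OF R] by (simp add: ennreal_plus ennreal_mult)
  qed
  also have "\<dots> = ennreal (huber R (y - x)) + ennreal (2 * R) * (\<integral>\<^sup>+\<omega>. ennreal \<bar>walk 0 \<omega> n\<bar> \<partial>\<Omega>)"
    by (simp add: nn_integral_add nn_integral_cmult)
  also have "\<dots> \<le> ennreal (huber R (y - x)) + ennreal (2 * R) * ennreal (sqrt (n * v))"
    by (intro add_left_mono mult_left_mono nn_integral_walk_abs) simp
  also have "ennreal (2 * R) * ennreal (sqrt (n * v)) = ennreal (2 * R * sqrt (n * v))"
    using R v_pos by (intro ennreal_mult[symmetric]) auto
  finally show ?thesis by (simp add: add.commute ennreal_add_left_cancel_le)
qed

end

section \<open>Blocks in which the walk meets a strip\<close>

lemma ennreal_le_divide_if_mult_le: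
  assumes "ennreal a * x \<le> ennreal b" "0 < a" "0 \<le> b"
  shows "x \<le> ennreal (b / a)"
proof (cases x)
  case (real r)
  then have "ennreal (a * r) \<le> ennreal b" using assms by (simp add: ennreal_mult)
  then have "a * r \<le> b" using assms(3) by (simp add: ennreal_le_iff)
  then have "r \<le> b / a" using assms(2) by (simp add: pos_le_divide_eq mult.commute)
  then show ?thesis unfolding real by (rule ennreal_leI)
next
  case top
  then have "\<top> \<le> ennreal b" using assms by (simp add: ennreal_mult_top)
  then show ?thesis by (simp add: top_unique)
qed

context centered_walk
begin

lemma measurable_of_nat_hit_blocks [measurable (raw)]:
  assumes "D \<in> sets borel" "f \<in> borel_measurable N" "g \<in> measurable N \<Omega>"
  shows "(\<lambda>x. of_nat (hit_blocks D m r (f x) (g x)) :: ennreal) \<in> borel_measurable N"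
    and "(\<lambda>x. of_nat (hit_blocks D m r (f x) (g x) choose p) :: ennreal) \<in> borel_measurable N"
proof -
  note meas = measurable_hit_blocks[OF assms, of m r]
  show "(\<lambda>x. of_nat (hit_blocks D m r (f x) (g x)) :: ennreal) \<in> borel_measurable N"
    using meas by (rule measurable_compose[where g = of_nat]) simp
  show "(\<lambda>x. of_nat (hit_blocks D m r (f x) (g x) choose p) :: ennreal) \<in> borel_measurable N"
    using meas by (rule measurable_compose[where g = "\<lambda>n. of_nat (n choose p)"]) simp
qed

text \<open>Chebyshev's inequality, in a form that avoids subtraction in \<^typ>\<open>ennreal\<close>.\<close>

lemma stays_close:
  assumes t: "t \<le> m" and \<rho>: "0 < \<rho>" "2 * real m * v \<le> \<rho>\<^sup>2"
  shows "1 \<le> 2 * (\<integral>\<^sup>+\<omega>. indicator {y - \<rho>..y + \<rho>} (walk y \<omega> t) \<partial>\<Omega>)"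
proof -
  let ?I = "\<integral>\<^sup>+\<omega>. indicator {y - \<rho>..y + \<rho>} (walk y \<omega> t) \<partial>\<Omega>"
  have "1 = (\<integral>\<^sup>+\<omega>. 1 \<partial>\<Omega>)" by simp
  also have "\<dots> \<le> (\<integral>\<^sup>+\<omega>. indicator {y - \<rho>..y + \<rho>} (walk y \<omega> t) + ennreal (1 / \<rho>\<^sup>2) * ennreal ((walk 0 \<omega> t)\<^sup>2) \<partial>\<Omega>)"
  proof (rule nn_integral_mono)
    fix \<omega>
    have eq: "walk y \<omega> t = y + walk 0 \<omega> t" by (simp add: walk_def)
    show "1 \<le> indicator {y - \<rho>..y + \<rho>} (walk y \<omega> t) + ennreal (1 / \<rho>\<^sup>2) * ennreal ((walk 0 \<omega> t)\<^sup>2)"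
    proof (cases "\<bar>walk 0 \<omega> t\<bar> \<le> \<rho>")
      case True
      then have "walk y \<omega> t \<in> {y - \<rho>..y + \<rho>}" unfolding eq by auto
      then show ?thesis by simp
    next
      case False
      then have "\<rho>\<^sup>2 \<le> (walk 0 \<omega> t)\<^sup>2" using \<rho>(1) by (simp add: abs_le_square_iff[symmetric])
      then have "ennreal 1 \<le> ennreal (1 / \<rho>\<^sup>2 * (walk 0 \<omega> t)\<^sup>2)"
        using \<rho>(1) by (intro ennreal_leI) (simp add: field_simps)
      also have "\<dots> = ennreal (1 / \<rho>\<^sup>2) * ennreal ((walk 0 \<omega> t)\<^sup>2)"
        by (intro ennreal_mult) auto
      also have "\<dots> \<le> indicator {y - \<rho>..y + \<rho>} (walk y \<omega> t) + \<dots>" by simp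
      finally show ?thesis by simp
    qed
  qed
  also have "\<dots> = ?I + ennreal (1 / \<rho>\<^sup>2) * ennreal (t * v)"
    by (simp add: nn_integral_add nn_integral_cmult nn_integral_walk_square)
  also have "ennreal (1 / \<rho>\<^sup>2) * ennreal (t * v) = ennreal (1 / \<rho>\<^sup>2 * (t * v))"
    using v_pos by (intro ennreal_mult[symmetric]) auto
  also have "\<dots> \<le> ennreal (1 / 2)"
  proof (rule ennreal_leI)
    have "t * v \<le> m * v" using t v_pos by simp
    then have "2 * (t * v) \<le> \<rho>\<^sup>2" using \<rho>(2) by linarith
    then show "1 / \<rho>\<^sup>2 * (t * v) \<le> 1 / 2" using \<rho>(1) by (simp add: field_simps)
  qed
  finally have *: "1 \<le> ?I + ennreal (1 / 2)" by (simp add: add_left_mono)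
  show ?thesis
  proof (cases ?I)
    case (real r)
    then have "ennreal (r + 1 / 2) = ennreal r + ennreal (1 / 2)" by (intro ennreal_plus) auto
    then have "ennreal 1 \<le> ennreal (r + 1 / 2)" using * unfolding real(2) by (simp only: ennreal_1)
    then have "1 \<le> r + 1 / 2" using real(1) by (subst (asm) ennreal_le_iff) auto
    then have "1 \<le> 2 * r" by simp
    then have "ennreal 1 \<le> ennreal (2 * r)" by (rule ennreal_leI)
    then show ?thesis using real by (simp add: ennreal_mult)
  next
    case top
    then show ?thesis by (simp add: ennreal_mult_top)
  qed
qed

text \<open>
  Once the walk has met the strip, it spends in expectation at least half of the next \<open>m\<close> steps in the
  enlarged strip.  The induction on \<open>a\<close> follows the walk until the strip is met, which replaces the
  strong Markov property at that time.
\<close>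

lemma hit_le_occupation:
  assumes \<rho>: "0 < \<rho>" "2 * real m * v \<le> \<rho>\<^sup>2"
  shows "of_nat m * (\<integral>\<^sup>+\<omega>. of_bool (hit {x..z} a y \<omega>) \<partial>\<Omega>)
    \<le> 2 * (\<integral>\<^sup>+\<omega>. (\<Sum>t<a + m. indicator {x - \<rho>..z + \<rho>} (walk y \<omega> t)) \<partial>\<Omega>)"
proof (induction a arbitrary: y)
  case 0
  then show ?case by (simp add: hit_def)
next
  case (Suc a)
  define D where "D = {x - \<rho>..z + \<rho>}"
  have [measurable]: "D \<in> sets borel" by (simp add: D_def)
  show ?case
  proof (cases "y \<in> {x..z}")
    case True
    have "(\<integral>\<^sup>+\<omega>. of_bool (hit {x..z} (Suc a) y \<omega>) \<partial>\<Omega>) \<le> (\<integral>\<^sup>+\<omega>. 1 \<partial>\<Omega>)"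
      by (intro nn_integral_mono) auto
    then have "of_nat m * (\<integral>\<^sup>+\<omega>. of_bool (hit {x..z} (Suc a) y \<omega>) \<partial>\<Omega>) \<le> of_nat m * 1"
      by (intro mult_left_mono) auto
    also have "\<dots> = (\<Sum>t<m. 1)" by simp
    also have "\<dots> \<le> (\<Sum>t<m. 2 * (\<integral>\<^sup>+\<omega>. indicator D (walk y \<omega> t) \<partial>\<Omega>))"
    proof (rule sum_mono)
      fix t assume "t \<in> {..<m}"
      then have "1 \<le> 2 * (\<integral>\<^sup>+\<omega>. indicator {y - \<rho>..y + \<rho>} (walk y \<omega> t) \<partial>\<Omega>)"
        using \<rho> by (intro stays_close) auto
      also have "\<dots> \<le> 2 * (\<integral>\<^sup>+\<omega>. indicator D (walk y \<omega> t) \<partial>\<Omega>)"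
        using True by (intro mult_left_mono nn_integral_mono) (auto simp: D_def split: split_indicator)
      finally show "1 \<le> 2 * (\<integral>\<^sup>+\<omega>. indicator D (walk y \<omega> t) \<partial>\<Omega>)" .
    qed
    also have "\<dots> = 2 * (\<integral>\<^sup>+\<omega>. (\<Sum>t<m. indicator D (walk y \<omega> t)) \<partial>\<Omega>)"
      by (simp add: nn_integral_sum sum_distrib_left)
    also have "\<dots> \<le> 2 * (\<integral>\<^sup>+\<omega>. (\<Sum>t<Suc a + m. indicator D (walk y \<omega> t)) \<partial>\<Omega>)"
      by (intro mult_left_mono nn_integral_mono sum_mono2) auto
    finally show ?thesis unfolding D_def .
  next
    case False
    have hit_Suc: "hit {x..z} (Suc a) y (x' ## \<omega>) \<longleftrightarrow> hit {x..z} a (y + x') \<omega>" for x' \<omega>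
    proof
      assume "hit {x..z} (Suc a) y (x' ## \<omega>)"
      then obtain t where "t < Suc a" "walk y (x' ## \<omega>) t \<in> {x..z}" by (auto simp: hit_def)
      then show "hit {x..z} a (y + x') \<omega>" using False by (cases t) (auto simp: hit_def)
    next
      assume "hit {x..z} a (y + x') \<omega>"
      then obtain t where "t < a" "walk (y + x') \<omega> t \<in> {x..z}" by (auto simp: hit_def)
      then show "hit {x..z} (Suc a) y (x' ## \<omega>)" unfolding hit_def by (intro exI[of _ "Suc t"]) simp
    qed
    have "of_nat m * (\<integral>\<^sup>+\<omega>. of_bool (hit {x..z} (Suc a) y \<omega>) \<partial>\<Omega>) =
        of_nat m * (\<integral>\<^sup>+x'. \<integral>\<^sup>+\<omega>. of_bool (hit {x..z} (Suc a) y (x' ## \<omega>)) \<partial>\<Omega> \<partial>\<mu>)"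
      by (intro arg_cong[where f="\<lambda>i. of_nat m * i"] nn_integral_stream_space) measurable
    also have "\<dots> = (\<integral>\<^sup>+x'. of_nat m * (\<integral>\<^sup>+\<omega>. of_bool (hit {x..z} a (y + x') \<omega>) \<partial>\<Omega>) \<partial>\<mu>)"
      unfolding hit_Suc by (subst nn_integral_cmult) auto
    also have "\<dots> \<le> (\<integral>\<^sup>+x'. 2 * (\<integral>\<^sup>+\<omega>. (\<Sum>t<a + m. indicator D (walk (y + x') \<omega> t)) \<partial>\<Omega>) \<partial>\<mu>)"
      unfolding D_def by (intro nn_integral_mono Suc.IH)
    also have "\<dots> \<le> (\<integral>\<^sup>+x'. 2 * (\<integral>\<^sup>+\<omega>. (\<Sum>t<Suc a + m. indicator D (walk y (x' ## \<omega>) t)) \<partial>\<Omega>) \<partial>\<mu>)"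
      by (intro nn_integral_mono mult_left_mono)
        (auto simp: sum.lessThan_Suc_shift simp del: sum.lessThan_Suc)
    also have "\<dots> = 2 * (\<integral>\<^sup>+x'. \<integral>\<^sup>+\<omega>. (\<Sum>t<Suc a + m. indicator D (walk y (x' ## \<omega>) t)) \<partial>\<Omega> \<partial>\<mu>)"
      by (rule nn_integral_cmult) measurable
    also have "\<dots> = 2 * (\<integral>\<^sup>+\<omega>. (\<Sum>t<Suc a + m. indicator D (walk y \<omega> t)) \<partial>\<Omega>)"
      by (intro arg_cong[where f="\<lambda>i. 2 * i"] nn_integral_stream_space[symmetric]) measurable
    finally show ?thesis unfolding D_def .
  qed
qed

text \<open>
  The preceding lemma applied from the beginning of each block; the time windows are two blocks long
  because the strip may be met late in its block.
\<close>

lemma hit_blocks_le_occupation: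
  assumes \<rho>: "0 < \<rho>" "2 * real m * v \<le> \<rho>\<^sup>2"
  shows "of_nat m * (\<integral>\<^sup>+\<omega>. of_nat (hit_blocks {x..z} m r y \<omega>) \<partial>\<Omega>)
    \<le> 2 * (\<integral>\<^sup>+\<omega>. (\<Sum>j<r. \<Sum>t<2 * m. indicator {x - \<rho>..z + \<rho>} (walk y \<omega> (j * m + t))) \<partial>\<Omega>)"
proof (induction r arbitrary: y)
  case 0
  then show ?case by simp
next
  case (Suc r)
  define D where "D = {x - \<rho>..z + \<rho>}"
  have [measurable]: "D \<in> sets borel" by (simp add: D_def)
  have [measurable]: "{x..z} \<in> sets borel" by simp
  define F where "F = (\<lambda>y \<omega>. \<Sum>j<r. \<Sum>t<2 * m. indicator D (walk y \<omega> (j * m + t)) :: ennreal)"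
  have [measurable]: "case_prod F \<in> borel_measurable (borel \<Otimes>\<^sub>M \<Omega>)"
    unfolding F_def by measurable
  have "(\<integral>\<^sup>+\<omega>. of_nat (hit_blocks {x..z} m (Suc r) y \<omega>) \<partial>\<Omega>) =
      (\<integral>\<^sup>+\<omega>. of_bool (hit {x..z} m y \<omega>) + of_nat (hit_blocks {x..z} m r (walk y \<omega> m) (sdrop m \<omega>)) \<partial>\<Omega>)"
    by (simp only: hit_blocks.simps of_nat_add of_nat_of_bool)
  also have "\<dots> = (\<integral>\<^sup>+\<omega>. of_bool (hit {x..z} m y \<omega>) \<partial>\<Omega>) +
      (\<integral>\<^sup>+\<omega>. of_nat (hit_blocks {x..z} m r (walk y \<omega> m) (sdrop m \<omega>)) \<partial>\<Omega>)"
    by (rule nn_integral_add) measurable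
  also have "(\<integral>\<^sup>+\<omega>. of_nat (hit_blocks {x..z} m r (walk y \<omega> m) (sdrop m \<omega>)) \<partial>\<Omega>) =
      (\<integral>\<^sup>+\<omega>. \<integral>\<^sup>+\<omega>'. of_nat (hit_blocks {x..z} m r (walk y \<omega> m) \<omega>') \<partial>\<Omega> \<partial>\<Omega>)"
    by (rule nn_integral_markov) measurable
  finally have split: "(\<integral>\<^sup>+\<omega>. of_nat (hit_blocks {x..z} m (Suc r) y \<omega>) \<partial>\<Omega>) =
    (\<integral>\<^sup>+\<omega>. of_bool (hit {x..z} m y \<omega>) \<partial>\<Omega>) +
    (\<integral>\<^sup>+\<omega>. \<integral>\<^sup>+\<omega>'. of_nat (hit_blocks {x..z} m r (walk y \<omega> m) \<omega>') \<partial>\<Omega> \<partial>\<Omega>)" .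
  have first: "of_nat m * (\<integral>\<^sup>+\<omega>. of_bool (hit {x..z} m y \<omega>) \<partial>\<Omega>)
      \<le> 2 * (\<integral>\<^sup>+\<omega>. (\<Sum>t<2 * m. indicator D (walk y \<omega> t)) \<partial>\<Omega>)"
    using hit_le_occupation[OF \<rho>, of x z m y] unfolding mult_2 D_def .
  have "of_nat m * (\<integral>\<^sup>+\<omega>. \<integral>\<^sup>+\<omega>'. of_nat (hit_blocks {x..z} m r (walk y \<omega> m) \<omega>') \<partial>\<Omega> \<partial>\<Omega>)
      = (\<integral>\<^sup>+\<omega>. of_nat m * (\<integral>\<^sup>+\<omega>'. of_nat (hit_blocks {x..z} m r (walk y \<omega> m) \<omega>') \<partial>\<Omega>) \<partial>\<Omega>)"
    by (rule nn_integral_cmult[symmetric]) measurable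
  also have "\<dots> \<le> (\<integral>\<^sup>+\<omega>. 2 * (\<integral>\<^sup>+\<omega>'. F (walk y \<omega> m) \<omega>' \<partial>\<Omega>) \<partial>\<Omega>)"
    unfolding F_def D_def by (intro nn_integral_mono Suc.IH)
  also have "\<dots> = 2 * (\<integral>\<^sup>+\<omega>. \<integral>\<^sup>+\<omega>'. F (walk y \<omega> m) \<omega>' \<partial>\<Omega> \<partial>\<Omega>)"
    by (rule nn_integral_cmult) measurable
  also have "(\<integral>\<^sup>+\<omega>. \<integral>\<^sup>+\<omega>'. F (walk y \<omega> m) \<omega>' \<partial>\<Omega> \<partial>\<Omega>) = (\<integral>\<^sup>+\<omega>. F (walk y \<omega> m) (sdrop m \<omega>) \<partial>\<Omega>)"
    by (rule nn_integral_markov[symmetric]) measurable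
  also have "\<dots> = (\<integral>\<^sup>+\<omega>. (\<Sum>j<r. \<Sum>t<2 * m. indicator D (walk y \<omega> (Suc j * m + t))) \<partial>\<Omega>)"
    by (simp only: F_def walk_sdrop mult_Suc add.assoc)
  finally have second: "of_nat m * (\<integral>\<^sup>+\<omega>. \<integral>\<^sup>+\<omega>'. of_nat (hit_blocks {x..z} m r (walk y \<omega> m) \<omega>') \<partial>\<Omega> \<partial>\<Omega>)
      \<le> 2 * (\<integral>\<^sup>+\<omega>. (\<Sum>j<r. \<Sum>t<2 * m. indicator D (walk y \<omega> (Suc j * m + t))) \<partial>\<Omega>)" .
  have "of_nat m * (\<integral>\<^sup>+\<omega>. of_nat (hit_blocks {x..z} m (Suc r) y \<omega>) \<partial>\<Omega>) \<le>
      2 * (\<integral>\<^sup>+\<omega>. (\<Sum>t<2 * m. indicator D (walk y \<omega> t)) \<partial>\<Omega>) +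
      2 * (\<integral>\<^sup>+\<omega>. (\<Sum>j<r. \<Sum>t<2 * m. indicator D (walk y \<omega> (Suc j * m + t))) \<partial>\<Omega>)"
    unfolding split distrib_left by (rule add_mono[OF first second])
  also have "\<dots> = 2 * ((\<integral>\<^sup>+\<omega>. (\<Sum>t<2 * m. indicator D (walk y \<omega> t)) \<partial>\<Omega>) +
      (\<integral>\<^sup>+\<omega>. (\<Sum>j<r. \<Sum>t<2 * m. indicator D (walk y \<omega> (Suc j * m + t))) \<partial>\<Omega>))"
    by (simp only: distrib_left)
  also have "(\<integral>\<^sup>+\<omega>. (\<Sum>t<2 * m. indicator D (walk y \<omega> t)) \<partial>\<Omega>) +
      (\<integral>\<^sup>+\<omega>. (\<Sum>j<r. \<Sum>t<2 * m. indicator D (walk y \<omega> (Suc j * m + t))) \<partial>\<Omega>) =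
      (\<integral>\<^sup>+\<omega>. (\<Sum>t<2 * m. indicator D (walk y \<omega> t)) +
        (\<Sum>j<r. \<Sum>t<2 * m. indicator D (walk y \<omega> (Suc j * m + t))) \<partial>\<Omega>)"
    by (rule nn_integral_add[symmetric]) measurable
  also have "\<dots> = (\<integral>\<^sup>+\<omega>. (\<Sum>j<Suc r. \<Sum>t<2 * m. indicator D (walk y \<omega> (j * m + t))) \<partial>\<Omega>)"
    by (simp only: sum.lessThan_Suc_shift[of _ r] mult_zero_left add_0)
  finally show ?case unfolding D_def .
qed

text \<open>
  With \<open>R\<close> of order \<open>sqrt m\<close> the occupation time up to \<open>(r + 1) * m\<close> is of order \<open>m * sqrt (r + 1)\<close>,
  and every block in which the strip is met accounts for about \<open>m / 2\<close> of it.
\<close>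

lemma expected_hit_blocks:
  obtains C where "0 < C"
    "\<And>m r x y. 1 \<le> m \<Longrightarrow> (\<integral>\<^sup>+\<omega>. of_nat (hit_blocks {x..x + 2 * sqrt (real m)} m r y \<omega>) \<partial>\<Omega>)
      \<le> ennreal (C * sqrt (real r + 1))"
proof -
  obtain T where T: "0 < T" "\<And>R. T \<le> R \<Longrightarrow> v / 2 \<le> (\<integral>x. (if \<bar>x\<bar> \<le> R then x\<^sup>2 else 0) \<partial>\<mu>)"
    using exists_truncation by blast
  \<comment> \<open>The quadratic region of half width \<open>R\<close>, where \<open>R / 2 = \<kappa> * sqrt m\<close>, has to be wide enough both for the truncation and for the enlarged strip in its inner half.\<close>
  define \<kappa> where "\<kappa> = max T (1 + sqrt (2 * v))"
  have \<kappa>: "0 < \<kappa>" "T \<le> \<kappa>" "1 + sqrt (2 * v) \<le> \<kappa>" using T by (auto simp: \<kappa>_def)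
  show thesis
  proof (rule that[of "32 * \<kappa> / sqrt v"])
    show "0 < 32 * \<kappa> / sqrt v" using \<kappa> v_pos by simp
    fix m r :: nat and x y :: real
    assume m: "1 \<le> m"
    define \<rho> where "\<rho> = sqrt (2 * v) * sqrt m"
    define R where "R = 2 * \<kappa> * sqrt m"
    define c where "c = x + sqrt m"
    have sm: "1 \<le> sqrt m" using m by simp
    have \<rho>: "0 < \<rho>" "2 * real m * v \<le> \<rho>\<^sup>2"
      using m v_pos by (simp_all add: \<rho>_def power_mult_distrib)
    have "T \<le> \<kappa> * 1" using \<kappa> by simp
    also have "\<dots> \<le> R / 2" using sm \<kappa>(1) unfolding R_def by simp
    finally have trunc: "v / 2 \<le> (\<integral>x. (if \<bar>x\<bar> \<le> R/2 then x\<^sup>2 else 0) \<partial>\<mu>)" by (rule T(2))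
    have R: "0 \<le> R" using \<kappa>(1) by (simp add: R_def)
    have "(1 + sqrt (2 * v)) * sqrt m \<le> \<kappa> * sqrt m" using \<kappa>(3) by (intro mult_right_mono) auto
    then have half: "sqrt m + \<rho> \<le> R / 2" by (simp add: \<rho>_def R_def algebra_simps)
    then have sub: "{x - \<rho>..x + 2 * sqrt m + \<rho>} \<subseteq> {c - R/2..c + R/2}"
      unfolding c_def by auto
    let ?E = "\<integral>\<^sup>+\<omega>. of_nat (hit_blocks {x..x + 2 * sqrt (real m)} m r y \<omega>) \<partial>\<Omega>"
    let ?D = "{c - R/2..c + R/2}"
    have "of_nat m * ?E \<le>
        2 * (\<integral>\<^sup>+\<omega>. (\<Sum>j<r. \<Sum>t<2 * m. indicator {x - \<rho>..x + 2 * sqrt m + \<rho>} (walk y \<omega> (j * m + t))) \<partial>\<Omega>)"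
      by (rule hit_blocks_le_occupation[OF \<rho>])
    also have "\<dots> \<le> 2 * (\<integral>\<^sup>+\<omega>. (\<Sum>j<r. \<Sum>t<2 * m. indicator ?D (walk y \<omega> (j * m + t))) \<partial>\<Omega>)"
    proof (intro mult_left_mono nn_integral_mono sum_mono)
      fix \<omega> j t
      show "indicator {x - \<rho>..x + 2 * sqrt m + \<rho>} (walk y \<omega> (j * m + t))
          \<le> (indicator ?D (walk y \<omega> (j * m + t)) :: ennreal)"
        using sub unfolding indicator_def by (simp add: subset_iff)
    qed simp
    also have "\<dots> \<le> 2 * (\<integral>\<^sup>+\<omega>. 2 * (\<Sum>t<Suc r * m. indicator ?D (walk y \<omega> t)) \<partial>\<Omega>)"
      by (intro mult_left_mono nn_integral_mono sum_overlapping_blocks_le) simp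
    also have "\<dots> = 2 * (2 * (\<integral>\<^sup>+\<omega>. (\<Sum>t<Suc r * m. indicator ?D (walk y \<omega> t)) \<partial>\<Omega>))"
      by (intro arg_cong[where f="\<lambda>i. 2 * i"] nn_integral_cmult) measurable
    finally have "ennreal (v / 2) * (of_nat m * ?E) \<le>
        ennreal (v / 2) * (2 * (2 * (\<integral>\<^sup>+\<omega>. (\<Sum>t<Suc r * m. indicator ?D (walk y \<omega> t)) \<partial>\<Omega>)))"
      by (rule mult_left_mono) simp
    also have "\<dots> = 4 * (ennreal (v / 2) * (\<integral>\<^sup>+\<omega>. (\<Sum>t<Suc r * m. indicator ?D (walk y \<omega> t)) \<partial>\<Omega>))"
      by (simp add: mult_ac flip: mult.assoc)
    also have "\<dots> \<le> 4 * ennreal (2 * R * sqrt (Suc r * m * v))"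
      using occupation_bound[OF R trunc, where n = "Suc r * m" and x = c and y = y] by (intro mult_left_mono) auto
    also have "\<dots> = ennreal (4 * (2 * R * sqrt (Suc r * m * v)))"
    proof -
      have "4 * ennreal b = ennreal (4 * b)" if "0 \<le> b" for b
        using that by (simp add: ennreal_mult)
      then show ?thesis by this (use R v_pos in simp)
    qed
    finally have "ennreal (v / 2) * (of_nat m * ?E) \<le> ennreal (4 * (2 * R * sqrt (Suc r * m * v)))" .
    moreover have "ennreal (v / 2 * m) = ennreal (v / 2) * of_nat m"
      using v_pos by (subst ennreal_mult) (auto simp: ennreal_of_nat_eq_real_of_nat)
    ultimately have "ennreal (v / 2 * m) * ?E \<le> ennreal (4 * (2 * R * sqrt (Suc r * m * v)))"
      by (simp only: mult.assoc)
    then have "?E \<le> ennreal (4 * (2 * R * sqrt (Suc r * m * v)) / (v / 2 * m))"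
      using v_pos m R by (intro ennreal_le_divide_if_mult_le) auto
    also have "4 * (2 * R * sqrt (Suc r * m * v)) / (v / 2 * m) = 32 * \<kappa> / sqrt v * sqrt (real r + 1)"
    proof -
      have sq: "sqrt m * sqrt m = m" "sqrt v * sqrt v = v" using v_pos by simp_all
      have "sqrt (Suc r * m * v) = sqrt (real r + 1) * sqrt m * sqrt v"
      proof -
        have "real (Suc r) = real r + 1" by simp
        then show ?thesis by (simp only: of_nat_mult real_sqrt_mult)
      qed
      moreover have "4 * (2 * (2 * \<kappa> * a) * (c * a * b)) / (b * b / 2 * (a * a)) = 32 * \<kappa> / b * c"
        if "0 < a" "0 < b" for a b c :: real
        using that by (simp add: field_simps)
      from this[of "sqrt m" "sqrt v" "sqrt (real r + 1)"] have
        "4 * (2 * R * (sqrt (real r + 1) * sqrt m * sqrt v)) / (v / 2 * m) = 32 * \<kappa> / sqrt v * sqrt (real r + 1)"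
        unfolding sq R_def using m v_pos by simp
      ultimately show ?thesis by simp
    qed
    finally show "?E \<le> ennreal (32 * \<kappa> / sqrt v * sqrt (real r + 1))" .
  qed
qed

text \<open>
  \<open>N choose p\<close> counts the \<open>p\<close>-element sets of blocks in which \<open>D\<close> is met.  Given its first element,
  the other \<open>p - 1\<close> lie in later blocks, and by the Markov property their expected number is at most
  \<open>\<Lambda> ^ (p - 1)\<close>, wherever the walk is at the end of the first.  The inner induction therefore proves the
  bound \<open>\<Lambda> ^ p\<close> times the mean of \<open>N\<close> for \<open>p + 1\<close>, in which the dependence on \<open>y\<close> is retained.
\<close>

lemma factorial_moment_hit_blocks:
  assumes [measurable]: "D \<in> sets borel"
    and first: "\<And>r y. r \<le> R \<Longrightarrow> (\<integral>\<^sup>+\<omega>. of_nat (hit_blocks D m r y \<omega>) \<partial>\<Omega>) \<le> \<Lambda>"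
  shows "r \<le> R \<Longrightarrow> (\<integral>\<^sup>+\<omega>. of_nat (hit_blocks D m r y \<omega> choose p) \<partial>\<Omega>) \<le> \<Lambda> ^ p"
proof (induction p arbitrary: r y)
  case 0
  then show ?case by simp
next
  case (Suc p)
  note lower = Suc.IH
  have "(\<integral>\<^sup>+\<omega>. of_nat (hit_blocks D m r y \<omega> choose Suc p) \<partial>\<Omega>)
      \<le> \<Lambda> ^ p * (\<integral>\<^sup>+\<omega>. of_nat (hit_blocks D m r y \<omega>) \<partial>\<Omega>)" if "r \<le> R" for r y
    using that
  proof (induction r arbitrary: y)
    case 0
    then show ?case by simp
  next
    case (Suc r)
    let ?N = "\<lambda>\<omega>. hit_blocks D m r (walk y \<omega> m) (sdrop m \<omega>)"
    let ?H = "\<integral>\<^sup>+\<omega>. of_bool (hit D m y \<omega>) \<partial>\<Omega>"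
    have choose: "of_nat (hit_blocks D m (Suc r) y \<omega> choose Suc p) =
        (of_nat (?N \<omega> choose Suc p) + of_bool (hit D m y \<omega>) * of_nat (?N \<omega> choose p) :: ennreal)" for \<omega>
      by (cases "hit D m y \<omega>") simp_all
    have shift_hit: "hit D m y (stake m \<omega> @- \<omega>') = hit D m y \<omega>" for \<omega> \<omega>'
      by (simp add: hit_def walk_stake_shift cong: conj_cong)
    have "(\<integral>\<^sup>+\<omega>. of_nat (?N \<omega> choose Suc p) \<partial>\<Omega>) =
        (\<integral>\<^sup>+\<omega>. \<integral>\<^sup>+\<omega>'. of_nat (hit_blocks D m r (walk y \<omega> m) \<omega>' choose Suc p) \<partial>\<Omega> \<partial>\<Omega>)"
      by (rule nn_integral_markov) measurable
    also have "\<dots> \<le> (\<integral>\<^sup>+\<omega>. \<Lambda> ^ p * (\<integral>\<^sup>+\<omega>'. of_nat (hit_blocks D m r (walk y \<omega> m) \<omega>') \<partial>\<Omega>) \<partial>\<Omega>)"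
      using Suc.prems by (intro nn_integral_mono Suc.IH) simp
    also have "\<dots> = \<Lambda> ^ p * (\<integral>\<^sup>+\<omega>. \<integral>\<^sup>+\<omega>'. of_nat (hit_blocks D m r (walk y \<omega> m) \<omega>') \<partial>\<Omega> \<partial>\<Omega>)"
      by (rule nn_integral_cmult) measurable
    also have "(\<integral>\<^sup>+\<omega>. \<integral>\<^sup>+\<omega>'. of_nat (hit_blocks D m r (walk y \<omega> m) \<omega>') \<partial>\<Omega> \<partial>\<Omega>) = (\<integral>\<^sup>+\<omega>. of_nat (?N \<omega>) \<partial>\<Omega>)"
      by (rule nn_integral_markov[symmetric]) measurable
    finally have A: "(\<integral>\<^sup>+\<omega>. of_nat (?N \<omega> choose Suc p) \<partial>\<Omega>) \<le> \<Lambda> ^ p * (\<integral>\<^sup>+\<omega>. of_nat (?N \<omega>) \<partial>\<Omega>)" .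
    have "(\<integral>\<^sup>+\<omega>. of_bool (hit D m y \<omega>) * of_nat (?N \<omega> choose p) \<partial>\<Omega>) =
        (\<integral>\<^sup>+\<omega>. \<integral>\<^sup>+\<omega>'. of_bool (hit D m y (stake m \<omega> @- \<omega>')) * of_nat (?N (stake m \<omega> @- \<omega>') choose p) \<partial>\<Omega> \<partial>\<Omega>)"
      by (rule nn_integral_stake) measurable
    also have "\<dots> = (\<integral>\<^sup>+\<omega>. \<integral>\<^sup>+\<omega>'. of_bool (hit D m y \<omega>) * of_nat (hit_blocks D m r (walk y \<omega> m) \<omega>' choose p) \<partial>\<Omega> \<partial>\<Omega>)"
      by (simp add: shift_hit walk_stake_shift sdrop_shift)
    also have "\<dots> = (\<integral>\<^sup>+\<omega>. of_bool (hit D m y \<omega>) * (\<integral>\<^sup>+\<omega>'. of_nat (hit_blocks D m r (walk y \<omega> m) \<omega>' choose p) \<partial>\<Omega>) \<partial>\<Omega>)"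
      by (intro nn_integral_cong nn_integral_cmult) measurable
    also have "\<dots> \<le> (\<integral>\<^sup>+\<omega>. of_bool (hit D m y \<omega>) * \<Lambda> ^ p \<partial>\<Omega>)"
      using Suc.prems by (intro nn_integral_mono mult_left_mono lower) auto
    also have "\<dots> = \<Lambda> ^ p * ?H"
      by (subst nn_integral_multc) (auto simp: mult.commute)
    finally have B: "(\<integral>\<^sup>+\<omega>. of_bool (hit D m y \<omega>) * of_nat (?N \<omega> choose p) \<partial>\<Omega>) \<le> \<Lambda> ^ p * ?H" .
    have "(\<integral>\<^sup>+\<omega>. of_nat (hit_blocks D m (Suc r) y \<omega> choose Suc p) \<partial>\<Omega>) =
        (\<integral>\<^sup>+\<omega>. of_nat (?N \<omega> choose Suc p) \<partial>\<Omega>) +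
        (\<integral>\<^sup>+\<omega>. of_bool (hit D m y \<omega>) * of_nat (?N \<omega> choose p) \<partial>\<Omega>)"
      unfolding choose by (rule nn_integral_add) measurable
    also have "\<dots> \<le> \<Lambda> ^ p * (\<integral>\<^sup>+\<omega>. of_nat (?N \<omega>) \<partial>\<Omega>) + \<Lambda> ^ p * ?H"
      by (rule add_mono[OF A B])
    also have "\<dots> = \<Lambda> ^ p * (?H + (\<integral>\<^sup>+\<omega>. of_nat (?N \<omega>) \<partial>\<Omega>))"
      by (simp add: distrib_left add.commute)
    also have "?H + (\<integral>\<^sup>+\<omega>. of_nat (?N \<omega>) \<partial>\<Omega>) = (\<integral>\<^sup>+\<omega>. of_bool (hit D m y \<omega>) + of_nat (?N \<omega>) \<partial>\<Omega>)"
      by (rule nn_integral_add[symmetric]) measurable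
    finally show ?case by simp
  qed
  then have "(\<integral>\<^sup>+\<omega>. of_nat (hit_blocks D m r y \<omega> choose Suc p) \<partial>\<Omega>)
      \<le> \<Lambda> ^ p * (\<integral>\<^sup>+\<omega>. of_nat (hit_blocks D m r y \<omega>) \<partial>\<Omega>)"
    using Suc.prems by blast
  also have "\<dots> \<le> \<Lambda> ^ p * \<Lambda>"
    by (intro mult_left_mono first Suc.prems) simp
  finally show ?case by (simp add: mult.commute)
qed

text \<open>Markov's inequality for \<open>N choose p\<close>, with \<open>(q / p) ^ p \<le> q choose p\<close>.\<close>

lemma hit_blocks_tail:
  obtains C where "0 < C"
    "\<And>m r x y p q. \<lbrakk>1 \<le> m; 1 \<le> p; p \<le> q\<rbrakk> \<Longrightarrow>
      (\<integral>\<^sup>+\<omega>. of_bool (q \<le> hit_blocks {x..x + 2 * sqrt (real m)} m r y \<omega>) \<partial>\<Omega>)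
      \<le> ennreal ((C * p * sqrt (real r + 1) / q) ^ p)"
proof -
  obtain C where C: "0 < C"
    "\<And>m r x y. 1 \<le> m \<Longrightarrow> (\<integral>\<^sup>+\<omega>. of_nat (hit_blocks {x..x + 2 * sqrt (real m)} m r y \<omega>) \<partial>\<Omega>)
      \<le> ennreal (C * sqrt (real r + 1))"
    using expected_hit_blocks by blast
  show thesis
  proof (rule that[OF C(1)])
    fix m r p q :: nat and x y :: real
    assume m: "1 \<le> m" and p: "1 \<le> p" "p \<le> q"
    define D where "D = {x..x + 2 * sqrt (real m)}"
    have [measurable]: "D \<in> sets borel" by (simp add: D_def)
    define \<Lambda> where "\<Lambda> = C * sqrt (real r + 1)"
    have \<Lambda>: "0 \<le> \<Lambda>" using C(1) by (simp add: \<Lambda>_def)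
    have first: "(\<integral>\<^sup>+\<omega>. of_nat (hit_blocks D m r' y \<omega>) \<partial>\<Omega>) \<le> ennreal \<Lambda>" if "r' \<le> r" for r' y
    proof -
      have "(\<integral>\<^sup>+\<omega>. of_nat (hit_blocks D m r' y \<omega>) \<partial>\<Omega>) \<le> ennreal (C * sqrt (real r' + 1))"
        unfolding D_def by (rule C(2)[OF m])
      also have "\<dots> \<le> ennreal \<Lambda>" unfolding \<Lambda>_def using that C(1) by (intro ennreal_leI mult_left_mono) auto
      finally show ?thesis .
    qed
    have "ennreal ((q / p) ^ p) * (\<integral>\<^sup>+\<omega>. of_bool (q \<le> hit_blocks D m r y \<omega>) \<partial>\<Omega>)
        = (\<integral>\<^sup>+\<omega>. ennreal ((q / p) ^ p) * of_bool (q \<le> hit_blocks D m r y \<omega>) \<partial>\<Omega>)"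
      by (rule nn_integral_cmult[symmetric]) measurable
    also have "\<dots> \<le> (\<integral>\<^sup>+\<omega>. of_nat (hit_blocks D m r y \<omega> choose p) \<partial>\<Omega>)"
    proof (rule nn_integral_mono)
      fix \<omega>
      show "ennreal ((q / p) ^ p) * of_bool (q \<le> hit_blocks D m r y \<omega>) \<le> of_nat (hit_blocks D m r y \<omega> choose p)"
      proof (cases "q \<le> hit_blocks D m r y \<omega>")
        case True
        have "(q / p) ^ p \<le> real (q choose p)"
          using binomial_ge_n_over_k_pow_k[OF p(2), where 'a=real] by simp
        also have "\<dots> \<le> real (hit_blocks D m r y \<omega> choose p)"
          using True by (simp add: binomial_right_mono)
        finally show ?thesis using True by (simp add: ennreal_of_nat_eq_real_of_nat ennreal_leI)
      qed simp
    qed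
    also have "\<dots> \<le> ennreal \<Lambda> ^ p"
      by (rule factorial_moment_hit_blocks[where R=r]) (auto intro: first)
    also have "\<dots> = ennreal (\<Lambda> ^ p)" using \<Lambda> by (simp add: ennreal_power)
    finally have "(\<integral>\<^sup>+\<omega>. of_bool (q \<le> hit_blocks D m r y \<omega>) \<partial>\<Omega>) \<le> ennreal (\<Lambda> ^ p / (q / p) ^ p)"
      using p \<Lambda> by (intro ennreal_le_divide_if_mult_le) auto
    also have "\<Lambda> ^ p / (q / p) ^ p = (C * p * sqrt (real r + 1) / q) ^ p"
      by (simp add: \<Lambda>_def mult_ac flip: power_divide)
    finally show "(\<integral>\<^sup>+\<omega>. of_bool (q \<le> hit_blocks {x..x + 2 * sqrt (real m)} m r y \<omega>) \<partial>\<Omega>)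
        \<le> ennreal ((C * p * sqrt (real r + 1) / q) ^ p)" unfolding D_def .
  qed
qed

end

section \<open>The exceptional set of step sequences\<close>

context centered_walk
begin

lemma emeasure_Collect_pred:
  assumes [measurable]: "Measurable.pred \<Omega> P"
  shows "emeasure \<Omega> {\<omega>. P \<omega>} = (\<integral>\<^sup>+\<omega>. of_bool (P \<omega>) \<partial>\<Omega>)"
proof -
  have "{\<omega>. P \<omega>} \<in> sets \<Omega>"
    using assms by (simp add: pred_def)
  then have "emeasure \<Omega> {\<omega>. P \<omega>} = (\<integral>\<^sup>+\<omega>. indicator {\<omega>. P \<omega>} \<omega> \<partial>\<Omega>)" by simp
  also have "\<dots> = (\<integral>\<^sup>+\<omega>. of_bool (P \<omega>) \<partial>\<Omega>)"
    by (intro nn_integral_cong) (simp add: indicator_def of_bool_def)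
  finally show ?thesis .
qed

text \<open>
  An arbitrary strip of height \<open>\<delta>\<close> lies in one of height \<open>2 * \<delta>\<close> whose lower edge is at a multiple
  \<open>g * \<delta>\<close> above the position \<open>y\<close> at the beginning of the block.  Measuring heights from \<open>y\<close> makes
  the hits a function of the steps after the time \<open>t0\<close> alone.  Strips outside the range of the walk are
  not met at all, so finitely many \<open>g\<close> suffice.
\<close>

lemma few_hits_if_grid_good:
  fixes s j i K q m t0 :: nat and \<omega> :: "real stream" and x \<delta> V :: real
  defines "m \<equiv> s ^ (2 * j)" and "\<delta> \<equiv> real s ^ j" and "V \<equiv> real s ^ (K + 2)"
  defines "t0 \<equiv> i * (s\<^sup>2 * m)"
  assumes s: "1 \<le> s" and j: "j < K" and i: "i < s ^ (2 * (K - 1 - j))"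
    and range: "\<And>t u. t < s ^ (2 * K) \<Longrightarrow> u < s ^ (2 * K) \<Longrightarrow> walk 0 \<omega> t - walk 0 \<omega> u \<le> V"
    and grid: "\<And>g :: int. \<bar>g\<bar> \<le> 3 * int s ^ (K + 2) \<Longrightarrow>
      hit_blocks {g * \<delta>..g * \<delta> + 2 * sqrt (real m)} m (s\<^sup>2) 0 (sdrop t0 \<omega>) \<le> q"
  shows "card {c. c < s\<^sup>2 \<and> (\<exists>t. t div m = i * s\<^sup>2 + c \<and> walk 0 \<omega> t \<in> {x..x + \<delta>})} \<le> q"
    (is "card ?A \<le> q")
proof (cases "?A = {}")
  case True
  show ?thesis unfolding True by simp
next
  case False
  have m: "1 \<le> m" and \<delta>: "1 \<le> \<delta>" using s by (simp_all add: m_def \<delta>_def)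
  have V: "1 \<le> V" unfolding V_def using s by (intro one_le_power) simp
  have "\<delta>\<^sup>2 = real m"
    unfolding m_def \<delta>_def of_nat_power power_mult[symmetric] by (simp add: mult.commute)
  then have sqrt_m: "sqrt (real m) = \<delta>" using \<delta> by (intro real_sqrt_unique) auto
  have "2 * K = 2 * (K - 1 - j) + 2 + 2 * j" using j by simp
  then have len: "s ^ (2 * K) = s ^ (2 * (K - 1 - j)) * (s\<^sup>2 * m)"
    unfolding m_def by (simp only: power_add mult.assoc)
  have time: "t < s ^ (2 * K)" if "t div m = i * s\<^sup>2 + c" "c < s\<^sup>2" for t c
  proof -
    have "t div m < Suc i * s\<^sup>2" using that by simp
    also have "\<dots> \<le> s ^ (2 * (K - 1 - j)) * s\<^sup>2" using i by (intro mult_right_mono) auto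
    finally have "t < s ^ (2 * (K - 1 - j)) * s\<^sup>2 * m" using m by (simp add: div_less_iff_less_mult)
    then show ?thesis by (simp add: len mult.assoc)
  qed
  have t0: "t0 < s ^ (2 * K)"
    unfolding t0_def len using i s m by (intro mult_strict_right_mono) auto
  define y where "y = walk 0 \<omega> t0"
  define g where "g = \<lfloor>(x - y) / \<delta>\<rfloor>"
  have g: "g * \<delta> \<le> x - y" "x - y < (g + 1) * \<delta>"
  proof -
    have "real_of_int g \<le> (x - y) / \<delta>" "(x - y) / \<delta> < real_of_int g + 1"
      unfolding g_def by linarith+
    moreover have "0 < \<delta>" using \<delta> by linarith
    ultimately show "g * \<delta> \<le> x - y" "x - y < (g + 1) * \<delta>"
      by (simp_all add: pos_le_divide_eq pos_divide_less_eq)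
  qed
  from False obtain c t where t: "c < s\<^sup>2" "t div m = i * s\<^sup>2 + c" "walk 0 \<omega> t \<in> {x..x + \<delta>}" by blast
  have "walk 0 \<omega> t - y \<le> V" "y - walk 0 \<omega> t \<le> V"
    unfolding y_def using time[OF t(2,1)] t0 by (auto intro: range)
  then have up: "g * \<delta> \<le> V" and low: "- V < (g + 2) * \<delta>"
    using t(3) g by (auto simp: algebra_simps)
  have "real_of_int g \<le> V"
  proof (cases "0 \<le> g")
    case True
    then have "real_of_int g * 1 \<le> g * \<delta>" using \<delta> by (intro mult_left_mono) auto
    then show ?thesis using up by simp
  next
    case False
    then have "real_of_int g \<le> 0" by simp
    then show ?thesis using V by linarith
  qed
  moreover have "- V \<le> real_of_int g + 2"
  proof (cases "0 \<le> g + 2")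
    case True
    then have "0 \<le> real_of_int g + 2" by linarith
    then show ?thesis using V by linarith
  next
    case False
    then have "real_of_int g + 2 \<le> 0" by linarith
    then have "(real_of_int g + 2) * \<delta> \<le> (real_of_int g + 2) * 1" using \<delta> by (intro mult_left_mono_neg)
    then show ?thesis using low by simp
  qed
  ultimately have "\<bar>real_of_int g\<bar> \<le> 3 * V" using V by linarith
  then have "real_of_int \<bar>g\<bar> \<le> real_of_int (3 * int s ^ (K + 2))" by (simp add: V_def)
  then have g_le: "\<bar>g\<bar> \<le> 3 * int s ^ (K + 2)" by linarith
  have "?A \<subseteq> {c. c < s\<^sup>2 \<and> (\<exists>u<m. walk 0 (sdrop t0 \<omega>) (c * m + u) \<in> {g * \<delta>..g * \<delta> + 2 * sqrt (real m)})}"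
  proof safe
    fix c t assume c: "c < s\<^sup>2" "t div m = i * s\<^sup>2 + c" "walk 0 \<omega> t \<in> {x..x + \<delta>}"
    have "t = (i * s\<^sup>2 + c) * m + t mod m" using c(2) by (metis div_mult_mod_eq)
    then have t: "t = t0 + (c * m + t mod m)" by (simp add: t0_def algebra_simps)
    have "walk 0 \<omega> t = walk y (sdrop t0 \<omega>) (c * m + t mod m)"
      by (subst t) (simp add: y_def walk_sdrop)
    also have "\<dots> = walk 0 (sdrop t0 \<omega>) (c * m + t mod m) + y"
      using walk_translate[of 0 y] by simp
    finally have "walk 0 (sdrop t0 \<omega>) (c * m + t mod m) = walk 0 \<omega> t - y" by simp
    moreover have "walk 0 \<omega> t - y \<in> {g * \<delta>..g * \<delta> + 2 * \<delta>}"
      using c(3) g by (auto simp: algebra_simps)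
    ultimately show "\<exists>u<m. walk 0 (sdrop t0 \<omega>) (c * m + u) \<in> {g * \<delta>..g * \<delta> + 2 * sqrt (real m)}"
      unfolding sqrt_m using m by (intro exI[of _ "t mod m"]) simp
  qed
  then have "card ?A \<le> hit_blocks {g * \<delta>..g * \<delta> + 2 * sqrt (real m)} m (s\<^sup>2) 0 (sdrop t0 \<omega>)"
    unfolding hit_blocks_eq_card by (intro card_mono) auto
  also have "\<dots> \<le> q" by (rule grid[OF g_le])
  finally show ?thesis .
qed

text \<open>
  The exceptional set is the union of \<open>B1\<close>, where too many pieces of some block meet some strip of the
  grid, and \<open>B2\<close>, where the walk leaves an interval of length \<open>V\<close>.  There are at most
  \<open>7 * K * w ^ (K * (3 * K + 2))\<close> pairs of a block and a strip; \<open>p\<close> exceeds this exponent by one,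
  which leaves a factor \<open>1 / w\<close>.
\<close>

lemma exceptional_set:
  assumes K: "1 \<le> (K :: nat)"
  obtains C w0 where "0 < C" and "\<And>w. w0 \<le> w \<Longrightarrow> \<exists>B\<in>sets \<Omega>. emeasure \<Omega> B \<le> ennreal (C / real w) \<and>
    (\<forall>\<omega>. \<omega> \<notin> B \<longrightarrow> (\<forall>A. A \<subseteq> {..<w ^ (2 * K\<^sup>2)} \<longrightarrow> mono_on A (walk 0 \<omega>) \<longrightarrow>
      real (card A) \<le> real (K + 1) * real w ^ (K\<^sup>2 + 5 * K)))"
proof -
  obtain c where c: "0 < c" and tail: "\<And>m r x y p q. \<lbrakk>1 \<le> m; 1 \<le> p; p \<le> q\<rbrakk> \<Longrightarrow>
      (\<integral>\<^sup>+\<omega>. of_bool (q \<le> hit_blocks {x..x + 2 * sqrt (real m)} m r y \<omega>) \<partial>\<Omega>)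
      \<le> ennreal ((c * p * sqrt (real r + 1) / q) ^ p)"
    using hit_blocks_tail by blast
  define p where "p = K * (3 * K + 2) + 1"
  define C where "C = 7 * K * (2 * c * p) ^ p + 4 * v"
  show thesis
  proof (rule that)
    show "0 < C" unfolding C_def using c v_pos by (intro add_nonneg_pos) auto
    fix w assume w: "p \<le> w"
    have p1: "1 \<le> p" and w1: "1 \<le> w" using w by (simp_all add: p_def)
    define s where "s = w ^ K"
    have s1: "1 \<le> s" using w1 by (simp add: s_def)
    have ws: "w \<le> s" using w1 K by (simp add: s_def self_le_power)
    define M where "M = (\<lambda>j. s ^ (2 * j))"
    define D where "D = (\<lambda>j (g::int). {g * real s ^ j..g * real s ^ j + 2 * sqrt (real (M j))})"
    define E where "E = (\<lambda>(j, i, g). {\<omega>. s * w \<le> hit_blocks (D j g) (M j) (s\<^sup>2) 0 (sdrop (i * (s\<^sup>2 * M j)) \<omega>)})"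
    define G where "G = 3 * int s ^ (K + 2)"
    define I where "I = {..<K} \<times> {..<s ^ (2 * K)} \<times> {-G..G}"
    define B1 where "B1 = (\<Union>e\<in>I. E e)"
    define B2 where "B2 = {\<omega>. \<exists>t\<le>s ^ (2 * K). real s ^ (K + 2) / 2 \<le> \<bar>walk 0 \<omega> t\<bar>}"
    have [measurable]: "D j g \<in> sets borel" for j g by (simp add: D_def)
    have pred_E: "Measurable.pred \<Omega> (\<lambda>\<omega>. s * w \<le> hit_blocks (D j g) (M j) (s\<^sup>2) 0 (sdrop (i * (s\<^sup>2 * M j)) \<omega>))"
      for j i g by measurable
    have E_sets: "E e \<in> sets \<Omega>" for e
      using pred_E by (cases e) (simp add: E_def pred_def)
    have E_le: "emeasure \<Omega> (E e) \<le> ennreal ((2 * c * p / w) ^ p)" for e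
    proof (cases e)
      case (fields j i g)
      have "emeasure \<Omega> (E e) = (\<integral>\<^sup>+\<omega>. of_bool (s * w \<le> hit_blocks (D j g) (M j) (s\<^sup>2) 0 (sdrop (i * (s\<^sup>2 * M j)) \<omega>)) \<partial>\<Omega>)"
        unfolding fields E_def prod.case by (rule emeasure_Collect_pred[OF pred_E])
      also have "\<dots> = (\<integral>\<^sup>+\<omega>. of_bool (s * w \<le> hit_blocks (D j g) (M j) (s\<^sup>2) 0 \<omega>) \<partial>\<Omega>)"
        by (rule nn_integral_sdrop) measurable
      also have "\<dots> \<le> ennreal ((c * p * sqrt (real (s\<^sup>2) + 1) / (s * w)) ^ p)"
        unfolding D_def
      proof (rule tail)
        show "1 \<le> M j" using s1 by (simp add: M_def)
        show "p \<le> s * w" using w s1 by (metis le_trans mult_le_mono1 mult_1)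
      qed (rule p1)
      also have "\<dots> \<le> ennreal ((2 * c * p / w) ^ p)"
      proof (intro ennreal_leI power_mono)
        have "sqrt (real (s\<^sup>2) + 1) \<le> 2 * real s"
        proof (rule real_le_lsqrt)
          have "1 \<le> (real s)\<^sup>2" using s1 by simp
          then show "real (s\<^sup>2) + 1 \<le> (2 * real s)\<^sup>2" by (simp add: power_mult_distrib)
        qed simp
        then have "c * p * sqrt (real (s\<^sup>2) + 1) / (s * w) \<le> c * p * (2 * real s) / (s * w)"
          using c by (intro divide_right_mono mult_left_mono) auto
        also have "\<dots> = 2 * c * p / w" using s1 by simp
        finally show "c * p * sqrt (real (s\<^sup>2) + 1) / (s * w) \<le> 2 * c * p / w" .
        show "0 \<le> c * p * sqrt (real (s\<^sup>2) + 1) / (s * w)" using c by simp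
      qed
      finally show ?thesis .
    qed
    have fin_I: "finite I" by (simp add: I_def)
    have card_I: "real (card I) \<le> 7 * K * real w ^ (K * (3 * K + 2))"
    proof -
      have "G \<ge> 0" by (simp add: G_def)
      have "real (card {-G..G}) = 2 * real_of_int G + 1" using \<open>G \<ge> 0\<close> by simp
      also have "\<dots> = 6 * real s ^ (K + 2) + 1" by (simp add: G_def)
      also have "\<dots> \<le> 7 * real s ^ (K + 2)"
        using one_le_power[of "real s" "K + 2"] s1 by simp
      finally have "real (card {-G..G}) \<le> 7 * real s ^ (K + 2)" .
      then have "real K * (real s ^ (2 * K) * real (card {-G..G})) \<le> real K * (real s ^ (2 * K) * (7 * real s ^ (K + 2)))"
        by (intro mult_left_mono) auto
      moreover have "real (card I) = real K * (real s ^ (2 * K) * real (card {-G..G}))"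
        unfolding I_def card_cartesian_product by simp
      moreover have "real s ^ (2 * K) * real s ^ (K + 2) = real w ^ (K * (3 * K + 2))"
        unfolding s_def of_nat_power power_add[symmetric] power_mult[symmetric]
        by (simp add: algebra_simps)
      moreover have "real K * (real s ^ (2 * K) * (7 * real s ^ (K + 2))) =
          7 * K * (real s ^ (2 * K) * real s ^ (K + 2))"
        by (simp only: mult_ac)
      ultimately show ?thesis by (simp only:)
    qed
    have "emeasure \<Omega> B1 \<le> (\<Sum>e\<in>I. emeasure \<Omega> (E e))"
      unfolding B1_def using fin_I E_sets by (intro emeasure_subadditive_finite) auto
    also have "\<dots> \<le> (\<Sum>e\<in>I. ennreal ((2 * c * p / w) ^ p))"
      by (intro sum_mono E_le)
    also have "\<dots> = ennreal (card I * (2 * c * p / w) ^ p)"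
      using c by (simp add: ennreal_mult ennreal_of_nat_eq_real_of_nat)
    also have "\<dots> \<le> ennreal (7 * K * (2 * c * p) ^ p / w)"
    proof (rule ennreal_leI)
      have eq: "(2 * c * p / w) ^ p = (2 * c * p) ^ p / (real w * real w ^ (K * (3 * K + 2)))"
      proof -
        have "real w ^ p = real w * real w ^ (K * (3 * K + 2))" by (simp add: p_def)
        then show ?thesis unfolding power_divide by (simp only:)
      qed
      have "card I * (2 * c * p / w) ^ p \<le> 7 * K * real w ^ (K * (3 * K + 2)) * (2 * c * p / w) ^ p"
        using card_I c by (intro mult_right_mono) auto
      also have "\<dots> = 7 * K * (2 * c * p) ^ p / w"
        unfolding eq using w1 by simp
      finally show "card I * (2 * c * p / w) ^ p \<le> 7 * K * (2 * c * p) ^ p / w" .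
    qed
    finally have B1_le: "emeasure \<Omega> B1 \<le> ennreal (7 * K * (2 * c * p) ^ p / w)" .
    have pred_B2: "Measurable.pred \<Omega> (\<lambda>\<omega>. \<exists>t\<le>s ^ (2 * K). real s ^ (K + 2) / 2 \<le> \<bar>walk 0 \<omega> t\<bar>)"
      by measurable
    have "emeasure \<Omega> B2 = (\<integral>\<^sup>+\<omega>. of_bool (\<exists>t\<le>s ^ (2 * K). real s ^ (K + 2) / 2 \<le> \<bar>walk 0 \<omega> t\<bar>) \<partial>\<Omega>)"
      unfolding B2_def by (rule emeasure_Collect_pred[OF pred_B2])
    also have "\<dots> \<le> ennreal ((0\<^sup>2 + real (s ^ (2 * K)) * v) / (real s ^ (K + 2) / 2)\<^sup>2)"
      using s1 by (intro maximal_inequality) simp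
    also have "\<dots> \<le> ennreal (4 * v / w)"
    proof (rule ennreal_leI)
      have "(0\<^sup>2 + real (s ^ (2 * K)) * v) / (real s ^ (K + 2) / 2)\<^sup>2 = 4 * v / real s ^ 4"
      proof -
        have sq: "(real s ^ (K + 2) / 2)\<^sup>2 = real s ^ (2 * K) * real s ^ 4 / 4"
        proof -
          have "(K + 2) * 2 = 2 * K + 4" by simp
          then have "(real s ^ (K + 2))\<^sup>2 = real s ^ (2 * K) * real s ^ 4"
            by (simp only: power_mult[symmetric] power_add[of _ "2 * K" 4])
          then show ?thesis unfolding power_divide by simp
        qed
        show ?thesis unfolding sq using s1 by simp
      qed
      also have "\<dots> \<le> 4 * v / w"
      proof (rule divide_left_mono)
        have "real w \<le> real s ^ 1" using ws by simp
        also have "\<dots> \<le> real s ^ 4" using s1 by (intro power_increasing) auto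
        finally show "real w \<le> real s ^ 4" .
      qed (use v_pos s1 w1 in auto)
      finally show "(0\<^sup>2 + real (s ^ (2 * K)) * v) / (real s ^ (K + 2) / 2)\<^sup>2 \<le> 4 * v / w" .
    qed
    finally have B2_le: "emeasure \<Omega> B2 \<le> ennreal (4 * v / w)" .
    have B_sets: "B1 \<in> sets \<Omega>" "B2 \<in> sets \<Omega>"
      using fin_I E_sets pred_B2 by (auto simp: B1_def B2_def pred_def intro!: sets.finite_UN)
    have "emeasure \<Omega> (B1 \<union> B2) \<le> emeasure \<Omega> B1 + emeasure \<Omega> B2"
      using B_sets by (rule emeasure_subadditive)
    also have "\<dots> \<le> ennreal (7 * K * (2 * c * p) ^ p / w) + ennreal (4 * v / w)"
      by (rule add_mono[OF B1_le B2_le])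
    also have "\<dots> = ennreal (7 * K * (2 * c * p) ^ p / w + 4 * v / w)"
      using c v_pos by (intro ennreal_plus[symmetric]) auto
    also have "7 * K * (2 * c * p) ^ p / w + 4 * v / w = C / w"
      by (simp add: C_def add_divide_distrib)
    finally have measure_le: "emeasure \<Omega> (B1 \<union> B2) \<le> ennreal (C / w)" .
    have card_le: "real (card A) \<le> real (K + 1) * real w ^ (K\<^sup>2 + 5 * K)"
      if \<omega>: "\<omega> \<notin> B1 \<union> B2" and A: "A \<subseteq> {..<w ^ (2 * K\<^sup>2)}" and mono: "mono_on A (walk 0 \<omega>)" for \<omega> A
    proof -
      have len: "w ^ (2 * K\<^sup>2) = s ^ (2 * K)"
        unfolding s_def power_mult[symmetric] by (simp add: power2_eq_square mult_ac)
      have range: "walk 0 \<omega> t - walk 0 \<omega> u \<le> real s ^ (K + 2)"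
        if "t < s ^ (2 * K)" "u < s ^ (2 * K)" for t u
      proof -
        have "\<bar>walk 0 \<omega> t'\<bar> < real s ^ (K + 2) / 2" if "t' < s ^ (2 * K)" for t'
        proof -
          have "\<omega> \<notin> B2" using \<omega> by blast
          then have "\<not> real s ^ (K + 2) / 2 \<le> \<bar>walk 0 \<omega> t'\<bar>"
            unfolding B2_def mem_Collect_eq using less_imp_le[OF that] by blast
          then show ?thesis by linarith
        qed
        from this[OF that(1)] this[OF that(2)] show ?thesis by linarith
      qed
      have "real (card A) \<le> real (K + 1) * real s ^ 4 * real (s * w) ^ K"
      proof (rule increasing_card_le[OF A[unfolded len] mono s1 w1 range])
        fix j i x
        assume j: "j < K" and i: "i < s ^ (2 * (K - 1 - j))"
        have grid: "hit_blocks {g * real s ^ j..g * real s ^ j + 2 * sqrt (real (s ^ (2 * j)))}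
            (s ^ (2 * j)) (s\<^sup>2) 0 (sdrop (i * (s\<^sup>2 * s ^ (2 * j))) \<omega>) \<le> s * w"
          if "\<bar>g\<bar> \<le> 3 * int s ^ (K + 2)" for g
        proof -
          have "s ^ (2 * (K - 1 - j)) \<le> s ^ (2 * K)" using s1 by (intro power_increasing) auto
          then have "(j, i, g) \<in> I" using i j that by (auto simp: I_def G_def)
          then have "\<omega> \<notin> E (j, i, g)" using \<omega> by (auto simp: B1_def)
          then show ?thesis by (simp add: E_def D_def M_def)
        qed
        show "card {c. c < s\<^sup>2 \<and> (\<exists>t. t div s ^ (2 * j) = i * s\<^sup>2 + c \<and> walk 0 \<omega> t \<in> {x..x + real s ^ j})} \<le> s * w"
          by (rule few_hits_if_grid_good[OF s1 j i range grid])
      qed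
      also have "real (K + 1) * real s ^ 4 * real (s * w) ^ K = real (K + 1) * real w ^ (K\<^sup>2 + 5 * K)"
      proof -
        have "real s ^ 4 * real (s * w) ^ K = real w ^ (K * 4) * (real w ^ (K * K) * real w ^ K)"
          unfolding s_def of_nat_mult of_nat_power power_mult_distrib power_mult ..
        also have "\<dots> = real w ^ (K\<^sup>2 + 5 * K)"
          unfolding power_add[symmetric] by (simp add: power2_eq_square algebra_simps)
        finally show ?thesis by (simp only: mult.assoc)
      qed
      finally show ?thesis .
    qed
    show "\<exists>B\<in>sets \<Omega>. emeasure \<Omega> B \<le> ennreal (C / real w) \<and>
      (\<forall>\<omega>. \<omega> \<notin> B \<longrightarrow> (\<forall>A. A \<subseteq> {..<w ^ (2 * K\<^sup>2)} \<longrightarrow> mono_on A (walk 0 \<omega>) \<longrightarrow>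
        real (card A) \<le> real (K + 1) * real w ^ (K\<^sup>2 + 5 * K)))"
      using B_sets measure_le card_le by (intro bexI[of _ "B1 \<union> B2"]) auto
  qed
qed

end

section \<open>From independent variables to streams, and the limit\<close>

text \<open>The index shift is due to the family starting at 1.\<close>

lemma (in prob_space) distr_iid_stream:
  fixes X :: "nat \<Rightarrow> 'a \<Rightarrow> real"
  assumes indep: "indep_vars (\<lambda>_. borel) X {1..}"
    and ident: "\<And>i. i \<ge> 1 \<Longrightarrow> distr M borel (X i) = \<mu>"
  shows "(\<lambda>\<omega>. to_stream (\<lambda>i. X (Suc i) \<omega>)) \<in> measurable M (stream_space \<mu>)" (is ?meas)
    and "distr M (stream_space \<mu>) (\<lambda>\<omega>. to_stream (\<lambda>i. X (Suc i) \<omega>)) = stream_space \<mu>" (is ?distr)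
proof -
  have rv: "X i \<in> borel_measurable M" if "i \<in> {1..}" for i
    using indep that by (auto simp: indep_vars_def)
  have \<mu>: "prob_space \<mu>" and sets_\<mu>: "sets \<mu> = sets borel"
    using prob_space_distr[OF rv[of 1]] ident[of 1] by auto
  let ?B = "\<Pi>\<^sub>M i\<in>{1::nat..}. \<mu>"
  let ?R = "\<lambda>\<omega>. \<lambda>n\<in>UNIV. \<omega> (Suc n)"
  have meas_B: "(\<lambda>\<omega>. \<lambda>i\<in>{1..}. X i \<omega>) \<in> measurable M ?B"
    using rv by (intro measurable_restrict) (simp add: sets_\<mu> cong: measurable_cong_sets)
  have "distr M (\<Pi>\<^sub>M i\<in>{1..}. borel) (\<lambda>\<omega>. \<lambda>i\<in>{1..}. X i \<omega>) = (\<Pi>\<^sub>M i\<in>{1..}. distr M borel (X i))"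
    using indep indep_vars_iff_distr_eq_PiM'[of "{1..}" X "\<lambda>_. borel"] rv by blast
  also have "\<dots> = ?B" by (intro PiM_cong) (auto simp: ident)
  also have "distr M (\<Pi>\<^sub>M i\<in>{1..}. borel) (\<lambda>\<omega>. \<lambda>i\<in>{1..}. X i \<omega>) = distr M ?B (\<lambda>\<omega>. \<lambda>i\<in>{1..}. X i \<omega>)"
    by (intro distr_cong sets_PiM_cong) (auto simp: sets_\<mu>)
  finally have distr_B: "distr M ?B (\<lambda>\<omega>. \<lambda>i\<in>{1..}. X i \<omega>) = ?B" .
  have meas_R: "?R \<in> measurable ?B (\<Pi>\<^sub>M i\<in>UNIV. \<mu>)"
    by (intro measurable_restrict measurable_component_singleton) auto
  have distr_R: "distr ?B (\<Pi>\<^sub>M i\<in>UNIV. \<mu>) ?R = (\<Pi>\<^sub>M i\<in>UNIV. \<mu>)"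
    using distr_PiM_reindex[of "{1..}" "\<lambda>_. \<mu>" Suc UNIV] \<mu> by auto
  have comp: "to_stream (?R (\<lambda>i\<in>{1..}. X i \<omega>)) = to_stream (\<lambda>i. X (Suc i) \<omega>)" for \<omega>
    by (auto simp: restrict_def)
  have "(\<lambda>\<omega>. to_stream (?R (\<lambda>i\<in>{1..}. X i \<omega>))) \<in> measurable M (stream_space \<mu>)"
    by (rule measurable_compose[OF measurable_compose[OF meas_B meas_R] measurable_to_stream])
  then show ?meas unfolding comp .
  have "stream_space \<mu> = distr (\<Pi>\<^sub>M i\<in>UNIV. \<mu>) (stream_space \<mu>) to_stream"
    by (rule stream_space_eq_distr)
  also have "\<dots> = distr (distr (distr M ?B (\<lambda>\<omega>. \<lambda>i\<in>{1..}. X i \<omega>)) (\<Pi>\<^sub>M i\<in>UNIV. \<mu>) ?R) (stream_space \<mu>) to_stream"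
    unfolding distr_B distr_R ..
  also have "\<dots> = distr M (stream_space \<mu>) (\<lambda>\<omega>. to_stream (?R (\<lambda>i\<in>{1..}. X i \<omega>)))"
    unfolding distr_distr[OF meas_R meas_B]
      distr_distr[OF measurable_to_stream measurable_comp[OF meas_B meas_R]]
    by (simp only: comp_def)
  finally show ?distr unfolding comp by simp
qed

lemma walk_to_stream: "walk 0 (to_stream (\<lambda>i. X (Suc i) \<omega>)) = partial_sum X \<omega>"
proof
  fix t
  have "(\<Sum>i<t. X (Suc i) \<omega>) = (\<Sum>i=1..t. X i \<omega>)"
    by (rule sum.reindex_bij_witness[where i="\<lambda>i. i - 1" and j=Suc]) auto
  then show "walk 0 (to_stream (\<lambda>i. X (Suc i) \<omega>)) t = partial_sum X \<omega> t"
    by (simp add: walk_def partial_sum_def to_stream_def)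
qed

text \<open>This form shows that the event in question is measurable, and relates it to bounds for every increasing set.\<close>

lemma LIS_le_iff:
  "real (LIS S n) \<le> b \<longleftrightarrow> (\<forall>A\<in>Pow {0..<n}. mono_on A S \<longrightarrow> real (card A) \<le> b)"
proof -
  let ?L = "{card A |A. A \<subseteq> {0..<n} \<and> mono_on A S}"
  have "?L \<subseteq> card ` Pow {0..<n}" by auto
  then have fin: "finite ?L" by (rule finite_subset) simp
  have "mono_on {} S" by (simp add: mono_on_def)
  then have ne: "?L \<noteq> {}" by blast
  show ?thesis
  proof
    assume *: "real (LIS S n) \<le> b"
    show "\<forall>A\<in>Pow {0..<n}. mono_on A S \<longrightarrow> real (card A) \<le> b"
    proof safe
      fix A assume "A \<subseteq> {0..<n}" "mono_on A S"
      then have "card A \<le> LIS S n" unfolding LIS_def using fin by (intro Max_ge) blast+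
      then show "real (card A) \<le> b" using * by linarith
    qed
  next
    assume *: "\<forall>A\<in>Pow {0..<n}. mono_on A S \<longrightarrow> real (card A) \<le> b"
    have "LIS S n \<in> ?L" unfolding LIS_def using fin ne by (rule Max_in)
    then obtain A where "LIS S n = card A" "A \<in> Pow {0..<n}" "mono_on A S" by blast
    then show "real (LIS S n) \<le> b" using * by simp
  qed
qed

lemma sets_LIS_le:
  assumes [measurable]: "\<And>t. (\<lambda>\<omega>. S \<omega> t) \<in> borel_measurable M"
  shows "{\<omega>\<in>space M. real (LIS (S \<omega>) n) \<le> b} \<in> sets M"
proof -
  have mono: "Measurable.pred M (\<lambda>\<omega>. mono_on A (S \<omega>))" if "A \<subseteq> {0..<n}" for A
  proof -
    have [simp]: "finite A" using that finite_subset by blast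
    have "(\<lambda>\<omega>. mono_on A (S \<omega>)) = (\<lambda>\<omega>. \<forall>t\<in>A. \<forall>u\<in>A. t \<le> u \<longrightarrow> S \<omega> t \<le> S \<omega> u)"
      by (auto simp: mono_on_def)
    moreover have "Measurable.pred M (\<lambda>\<omega>. S \<omega> t \<le> S \<omega> u)" for t u by measurable
    then have "Measurable.pred M (\<lambda>\<omega>. \<forall>t\<in>A. \<forall>u\<in>A. t \<le> u \<longrightarrow> S \<omega> t \<le> S \<omega> u)"
      by (intro pred_intros_finite(3) pred_intros_imp') simp_all
    ultimately show ?thesis by simp
  qed
  have "Measurable.pred M (\<lambda>\<omega>. \<forall>A\<in>Pow {0..<n}. mono_on A (S \<omega>) \<longrightarrow> real (card A) \<le> b)"
    using mono by (intro pred_intros_finite(3) pred_intros_logic(4)) simp_all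
  then show ?thesis unfolding LIS_le_iff pred_def .
qed

text \<open>
  Rounding \<open>n powr (1 / (2 * K\<^sup>2))\<close> up to an integer at most doubles it, and constant factors are
  absorbed by the gap between \<open>5 / (2 * K)\<close> and \<open>\<epsilon>\<close>.
\<close>

lemma block_bound_eventually_le:
  fixes K :: nat
  assumes K: "1 \<le> K" and \<epsilon>: "5 / (2 * K) < \<epsilon>"
  shows "\<forall>\<^sub>F n::nat in sequentially.
    real (K + 1) * real (nat \<lceil>real n powr (1 / (2 * K\<^sup>2))\<rceil>) ^ (K\<^sup>2 + 5 * K) \<le> real n powr (1 / 2 + \<epsilon>)"
proof -
  define d where "d = \<epsilon> - 5 / (2 * K)"
  have d: "0 < d" using \<epsilon> by (simp add: d_def)
  have "filterlim (\<lambda>n::nat. real n powr d) at_top sequentially"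
    using d by real_asymp
  then have "\<forall>\<^sub>F n::nat in sequentially. real (K + 1) * 2 ^ (K\<^sup>2 + 5 * K) \<le> real n powr d"
    by (simp add: filterlim_at_top)
  then show ?thesis
    using eventually_ge_at_top[of 1]
  proof eventually_elim
    case (elim n)
    define u where "u = real n powr (1 / (2 * K\<^sup>2))"
    have u: "1 \<le> u" unfolding u_def using elim K by (intro ge_one_powr_ge_zero) auto
    have "real (nat \<lceil>u\<rceil>) \<le> 2 * u" using u by linarith
    then have "real (nat \<lceil>u\<rceil>) ^ (K\<^sup>2 + 5 * K) \<le> (2 * u) ^ (K\<^sup>2 + 5 * K)"
      by (intro power_mono) auto
    also have "\<dots> = 2 ^ (K\<^sup>2 + 5 * K) * real n powr (1 / (2 * K\<^sup>2) * (K\<^sup>2 + 5 * K))"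
      using elim unfolding u_def power_mult_distrib by (simp add: powr_powr flip: powr_realpow)
    also have "1 / (2 * K\<^sup>2) * (K\<^sup>2 + 5 * K) = 1 / 2 + 5 / (2 * real K)"
      using K by (simp add: field_simps power2_eq_square)
    finally have "real (K + 1) * real (nat \<lceil>u\<rceil>) ^ (K\<^sup>2 + 5 * K) \<le>
        real (K + 1) * (2 ^ (K\<^sup>2 + 5 * K) * real n powr (1 / 2 + 5 / (2 * real K)))"
      by (rule mult_left_mono) simp
    also have "\<dots> = (real (K + 1) * 2 ^ (K\<^sup>2 + 5 * K)) * real n powr (1 / 2 + 5 / (2 * real K))"
      by (simp only: mult.assoc)
    also have "\<dots> \<le> real n powr d * real n powr (1 / 2 + 5 / (2 * real K))"
      using elim by (intro mult_right_mono) auto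
    also have "\<dots> = real n powr (1 / 2 + \<epsilon>)"
      unfolding powr_add[symmetric] by (simp add: d_def add.commute)
    finally show ?case unfolding u_def .
  qed
qed

theorem corollary1p1:
  fixes M :: "'a measure" and X :: "nat \<Rightarrow> 'a \<Rightarrow> real" and \<epsilon> :: real
  assumes "prob_space M"
    and "prob_space.indep_vars M (\<lambda>_. borel) X {1..}"
    and "\<And>i. i \<ge> 1 \<Longrightarrow> distr M borel (X i) = distr M borel (X 1)"
    and "integrable M (X 1)"
    and "integrable M (\<lambda>\<omega>. (X 1 \<omega>)\<^sup>2)"
    and "prob_space.expectation M (X 1) = 0"
    and "prob_space.variance M (X 1) > 0"
    and "\<epsilon> > 0"
  shows "(\<lambda>n. prob_space.prob M
            {\<omega> \<in> space M. real (LIS (partial_sum X \<omega>) n) \<le> real n powr (1/2 + \<epsilon>)})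
          \<longlonglongrightarrow> 1"
proof -
  interpret prob_space M by fact
  define \<mu> where "\<mu> = distr M borel (X 1)"
  define T where "T = (\<lambda>\<omega>. to_stream (\<lambda>i. X (Suc i) \<omega>))"
  have rv: "X i \<in> borel_measurable M" if "i \<ge> 1" for i
    using assms(2) that by (auto simp: indep_vars_def)
  have rv1: "X 1 \<in> borel_measurable M" by (rule rv) simp
  interpret \<mu>: prob_space \<mu> unfolding \<mu>_def by (rule prob_space_distr[OF rv1])
  interpret centered_walk \<mu> "variance (X 1)"
  proof
    show "sets \<mu> = sets borel" by (simp add: \<mu>_def)
    show "integrable \<mu> (\<lambda>x. x)" unfolding \<mu>_def using rv1 assms(4) by (simp add: integrable_distr_eq)
    show "integrable \<mu> (\<lambda>x. x\<^sup>2)" unfolding \<mu>_def using rv1 assms(5) by (simp add: integrable_distr_eq)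
    show "(\<integral>x. x \<partial>\<mu>) = 0" unfolding \<mu>_def using rv1 assms(6) by (simp add: integral_distr)
    show "(\<integral>x. x\<^sup>2 \<partial>\<mu>) = variance (X 1)"
      unfolding \<mu>_def using rv1 assms(6) by (simp add: integral_distr)
    show "0 < variance (X 1)" by fact
  qed
  have ident: "distr M borel (X i) = \<mu>" if "i \<ge> 1" for i
    unfolding \<mu>_def using that by (rule assms(3))
  have T_meas: "T \<in> measurable M \<Omega>" and T_distr: "distr M \<Omega> T = \<Omega>"
    unfolding T_def using distr_iid_stream[OF assms(2) ident] by simp_all
  define K where "K = nat \<lceil>5 / (2 * \<epsilon>)\<rceil> + 1"
  have K: "1 \<le> K" by (simp add: K_def)
  have "5 / (2 * \<epsilon>) < real K" unfolding K_def by linarith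
  then have K_\<epsilon>: "5 / (2 * K) < \<epsilon>" using K \<open>\<epsilon> > 0\<close> by (simp add: field_simps)
  obtain C w0 where C: "0 < C" and except: "\<And>w. w0 \<le> w \<Longrightarrow> \<exists>B\<in>sets \<Omega>. emeasure \<Omega> B \<le> ennreal (C / real w) \<and>
    (\<forall>\<omega>. \<omega> \<notin> B \<longrightarrow> (\<forall>A. A \<subseteq> {..<w ^ (2 * K\<^sup>2)} \<longrightarrow> mono_on A (walk 0 \<omega>) \<longrightarrow>
      real (card A) \<le> real (K + 1) * real w ^ (K\<^sup>2 + 5 * K)))"
    using exceptional_set[OF K] by blast
  define w where "w = (\<lambda>n::nat. nat \<lceil>real n powr (1 / (2 * K\<^sup>2))\<rceil>)"
  have "filterlim (\<lambda>n::nat. real n powr (1 / (2 * K\<^sup>2))) at_top sequentially"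
  proof -
    have "0 < 1 / (2 * (real K)\<^sup>2)" using K by simp
    then have "filterlim (\<lambda>n::nat. real n powr (1 / (2 * (real K)\<^sup>2))) at_top sequentially"
      by real_asymp
    then show ?thesis by simp
  qed
  then have w_lim: "filterlim (\<lambda>n. real (w n)) at_top sequentially"
    by (rule filterlim_at_top_mono) (auto simp: w_def intro!: always_eventually)
  have w_large: "\<forall>\<^sub>F n in sequentially. max 1 w0 \<le> w n"
    using w_lim[unfolded filterlim_at_top, rule_format, of "real (max 1 w0)"]
    by eventually_elim simp
  let ?G = "\<lambda>n. {\<omega> \<in> space M. real (LIS (partial_sum X \<omega>) n) \<le> real n powr (1/2 + \<epsilon>)}"
  \<comment> \<open>\<open>w n\<close> is the least integer for which the horizon \<open>w n ^ (2 * K\<^sup>2)\<close> covers \<open>n\<close>.\<close>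
  have lower: "\<forall>\<^sub>F n in sequentially. 1 - C / real (w n) \<le> prob (?G n)"
    using w_large block_bound_eventually_le[OF K K_\<epsilon>] eventually_ge_at_top[of 1]
  proof eventually_elim
    case (elim n)
    have "w0 \<le> w n" using elim(1) by simp
    from except[OF this] obtain B where B: "B \<in> sets \<Omega>" "emeasure \<Omega> B \<le> ennreal (C / real (w n))"
      and good: "\<forall>\<omega>. \<omega> \<notin> B \<longrightarrow> (\<forall>A. A \<subseteq> {..<w n ^ (2 * K\<^sup>2)} \<longrightarrow> mono_on A (walk 0 \<omega>) \<longrightarrow>
        real (card A) \<le> real (K + 1) * real (w n) ^ (K\<^sup>2 + 5 * K))"
      by blast
    have "real n = (real n powr (1 / (2 * K\<^sup>2))) ^ (2 * K\<^sup>2)"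
    proof -
      have pos: "0 < real n" using elim(3) by simp
      then have "(real n powr (1 / (2 * K\<^sup>2))) ^ (2 * K\<^sup>2) = real n powr (1 / (2 * K\<^sup>2) * (2 * K\<^sup>2))"
        by (simp only: powr_realpow[symmetric] powr_powr powr_gt_zero)
      also have "1 / (2 * K\<^sup>2) * (2 * K\<^sup>2) = (1 :: real)" using K by simp
      finally show ?thesis using pos by simp
    qed
    also have "\<dots> \<le> real (w n) ^ (2 * K\<^sup>2)"
    proof (rule power_mono)
      show "real n powr (1 / (2 * K\<^sup>2)) \<le> real (w n)" unfolding w_def by linarith
    qed simp
    finally have n_le: "n \<le> w n ^ (2 * K\<^sup>2)" by (simp flip: of_nat_power)
    let ?E = "T -` B \<inter> space M"
    have E: "?E \<in> sets M" using T_meas B(1) by (rule measurable_sets)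
    have "ennreal (prob ?E) = emeasure (distr M \<Omega> T) B"
      using T_meas B(1) by (simp add: emeasure_distr emeasure_eq_measure)
    also have "\<dots> \<le> ennreal (C / real (w n))" unfolding T_distr by (rule B(2))
    finally have prob_E: "prob ?E \<le> C / real (w n)" using C by (simp add: ennreal_le_iff)
    have "space M - ?E \<subseteq> ?G n"
    proof
      fix \<omega> assume \<omega>: "\<omega> \<in> space M - ?E"
      have "real (card A) \<le> real n powr (1/2 + \<epsilon>)" if "A \<subseteq> {0..<n}" "mono_on A (partial_sum X \<omega>)" for A
      proof -
        have "A \<subseteq> {..<w n ^ (2 * K\<^sup>2)}" using that(1) n_le by auto
        moreover have "T \<omega> \<notin> B" using \<omega> by blast
        moreover have "mono_on A (walk 0 (T \<omega>))"
          using that(2) by (simp only: T_def walk_to_stream)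
        ultimately have "real (card A) \<le> real (K + 1) * real (w n) ^ (K\<^sup>2 + 5 * K)"
          using good by blast
        also have "\<dots> \<le> real n powr (1/2 + \<epsilon>)" using elim(2) by (simp only: w_def)
        finally show ?thesis .
      qed
      then have "real (LIS (partial_sum X \<omega>) n) \<le> real n powr (1/2 + \<epsilon>)"
        unfolding LIS_le_iff by blast
      then show "\<omega> \<in> ?G n" using \<omega> by blast
    qed
    moreover have "?G n \<in> sets M"
    proof (rule sets_LIS_le)
      show "(\<lambda>\<omega>. partial_sum X \<omega> t) \<in> borel_measurable M" for t
        unfolding partial_sum_def by (intro borel_measurable_sum rv) simp
    qed
    ultimately have "prob (space M - ?E) \<le> prob (?G n)" by (rule finite_measure_mono)
    then show ?case using prob_compl[OF E] prob_E by linarith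
  qed
  have "(\<lambda>n. 1 - C / real (w n)) \<longlonglongrightarrow> 1 - 0"
    by (intro tendsto_intros tendsto_divide_0[OF tendsto_const] filterlim_at_top_imp_at_infinity w_lim)
  then have limit: "(\<lambda>n. 1 - C / real (w n)) \<longlonglongrightarrow> 1" by simp
  have upper: "\<forall>\<^sub>F n in sequentially. prob (?G n) \<le> 1"
    by (intro always_eventually allI prob_le_1)
  show ?thesis by (rule tendsto_sandwich[OF lower upper limit tendsto_const])
qed
end
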